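(* Let $\theta,\rho\in\mathbb{R}$ with $|\theta|<1$, $|\rho|<1$, let $(V_n)_{n\ge1}$ be a sequence of independent and identically distributed real random variables with zero mean, variance $\sigma^2>0$ and finite moment of order $4$, let the initial values $X_0,\varepsilon_0$ be arbitrary, and for all $n\ge1$ let $X_n=\theta X_{n-1}+\varepsilon_n$ and $\varepsilon_n=\rho\varepsilon_{n-1}+V_n$. Let $$\widehat{\theta}_n=\frac{\sum_{k=1}^n X_kX_{k-1}}{\sum_{k=1}^n X_{k-1}^2},\qquad \theta^*=\frac{\theta+\rho}{1+\theta\rho},\qquad \sigma_\theta^2=\frac{(1-\theta^2)(1-\theta\rho)(1-\rho^2)}{(1+\theta\rho)^3}.$$ Then, as $n\to\infty$, $$\sqrt{n}\,\big(\widehat{\theta}_n-\theta^*\big)\longrightarrow\mathcal{N}(0,\sigma_\theta^2)\quad\text{in distribution}.$$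
   Context: $\widehat\theta_n$ is the least squares estimator of $\theta$. $\mathcal{N}(0,s^2)$ is the centered normal law with variance $s^2$. Convention: a quotient defining an estimator is read as $0$ if its denominator vanishes. *)

theory Defs
  imports "HOL-Probability.Probability"
begin

(* Division by zero is zero in HOL, so the estimator is 0 when its denominator vanishes. *)
definition ls_estimator :: "(nat \<Rightarrow> 'a \<Rightarrow> real) \<Rightarrow> nat \<Rightarrow> 'a \<Rightarrow> real" where
  "ls_estimator X n \<omega> = (\<Sum>k=1..n. X k \<omega> * X (k - 1) \<omega>) / (\<Sum>k=1..n. (X (k - 1) \<omega>)\<^sup>2)"

definition theta_star :: "real \<Rightarrow> real \<Rightarrow> real" where
  "theta_star \<theta> \<rho> = (\<theta> + \<rho>) / (1 + \<theta> * \<rho>)"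

definition sigma2_theta :: "real \<Rightarrow> real \<Rightarrow> real" where
  "sigma2_theta \<theta> \<rho> = ((1 - \<theta>\<^sup>2) * (1 - \<theta> * \<rho>) * (1 - \<rho>\<^sup>2)) / (1 + \<theta> * \<rho>) ^ 3"

(* The argument v is the variance, whereas normal_density takes the standard deviation.
   Only meaningful for v > 0: at v = 0 the density is identically zero and this is not the
   point mass at 0.  For |theta| < 1 and |rho| < 1 one has sigma2_theta theta rho > 0. *)
definition centered_normal :: "real \<Rightarrow> real measure" where
  "centered_normal v = density lborel (\<lambda>x. ennreal (normal_density 0 (sqrt v) x))"

end

theory Submission
  imports Defs
begin

text \<open>
  Subtracting \<open>\<theta>\<^sup>*\<close> times the denominator from the numerator of the estimator eliminates the
  autocorrelation of the noise: with \<open>S\<^sub>n = \<Sum>k<n. X\<^sub>k\<^sup>2\<close> one has, for every path,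
  \<open>(1 + \<theta> \<rho>) (\<Sum>k<n. X\<^bsub>k+1\<^esub> X\<^sub>k) = (\<theta> + \<rho>) S\<^sub>n + (\<Sum>k<n. X\<^sub>k V\<^bsub>k+1\<^esub>) + boundary terms\<close>
  (\<open>numerator_identity\<close>). The estimation error is therefore a sum of martingale differences
  divided by \<open>(1 + \<theta> \<rho>) S\<^sub>n\<close>, up to boundary terms that stay bounded in probability.
  Two limits are needed: a law of large numbers for \<open>S\<^sub>n / n\<close> and a central limit theorem for
  \<open>(\<Sum>k<n. X\<^sub>k V\<^bsub>k+1\<^esub>) / \<surd>n\<close>.

  Both come from one algebraic fact. Let \<open>x\<close> and \<open>e\<close> be the processes started at zero. There is a
  quadratic form \<open>G\<close> in \<open>(x, e)\<close>, the corrector, that solves the Poisson equation for \<open>x\<^sup>2\<close>: the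
  difference \<open>G\<^bsub>n+1\<^esub> - G\<^sub>n\<close> equals \<open>l - x\<^sub>n\<^sup>2\<close> plus a martingale difference, where \<open>l\<close> is the
  stationary variance (\<open>corrector_identity\<close>). Summing this identity gives
  \<open>\<Sum>k<n. x\<^sub>k\<^sup>2 = n l + O(\<surd>n)\<close> in mean square (\<open>sum_square_deviation\<close>). For the central limit theorem,
  put \<open>w\<^sub>k = exp (i s M\<^sub>k)\<close> with \<open>M\<^sub>k = \<Sum>j<k. x\<^sub>j V\<^bsub>j+1\<^esub>\<close>, \<open>s = t / \<surd>n\<close> and \<open>h = s\<^sup>2 \<sigma>\<^sup>2 / 2\<close>. A Taylor expansion gives
  \<open>E w\<^bsub>k+1\<^esub> = E w\<^sub>k - h E (w\<^sub>k x\<^sub>k\<^sup>2) + O(\<bar>s\<bar>\<^sup>3)\<close>, and the random factor \<open>x\<^sub>k\<^sup>2\<close> prevents one from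
  reading off \<open>E w\<^sub>n\<close>. Replacing \<open>E w\<^sub>k\<close> by \<open>z\<^sub>k = E w\<^sub>k - h E (w\<^sub>k G\<^sub>k)\<close> turns \<open>x\<^sub>k\<^sup>2\<close> into the constant
  \<open>l\<close>: \<open>z\<^bsub>k+1\<^esub> = (1 - h l) z\<^sub>k + O(\<bar>s\<bar>\<^sup>3)\<close>. After \<open>n\<close> steps the errors add up to \<open>O(1 / \<surd>n)\<close>, and
  \<open>(1 - h l)\<^sup>n\<close> tends to \<open>exp (- t\<^sup>2 \<sigma>\<^sup>2 l / 2)\<close> (\<open>char_transform_limit\<close>). All error
  bounds rest on fourth moments of \<open>x\<close> and \<open>e\<close>, which stay bounded because the recursions are
  contractions (\<open>fourth_moment_recursion\<close>).

  The given initial values need not have moments and may depend on the noise. Their influence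
  on \<open>X\<^sub>n\<close> decays geometrically path by path, so they change the two sums only by terms that
  are bounded in probability (\<open>bounded_mart_diff\<close>, \<open>bounded_S_diff\<close>). A Slutsky argument at the level
  of characteristic functions and the theorem of Levy finish the proof.
\<close>

section \<open>Stochastic boundedness and convergence to zero in probability\<close>

context prob_space
begin

text \<open>
  Convergence to zero in probability. Measurability is part of the notion, so that the
  closure properties below need no side conditions.
\<close>

definition vanishing :: "(nat \<Rightarrow> 'a \<Rightarrow> real) \<Rightarrow> bool" where
  "vanishing Y \<longleftrightarrow> (\<forall>n. Y n \<in> borel_measurable M) \<and>
     (\<forall>\<delta>>0. (\<lambda>n. prob {\<omega> \<in> space M. \<delta> < \<bar>Y n \<omega>\<bar>}) \<longlonglongrightarrow> 0)"

definition bounded_in_prob :: "(nat \<Rightarrow> 'a \<Rightarrow> real) \<Rightarrow> bool" where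
  "bounded_in_prob Y \<longleftrightarrow> (\<forall>n. Y n \<in> borel_measurable M) \<and>
     (\<forall>\<eta>>0. \<exists>K>0. \<forall>n. prob {\<omega> \<in> space M. K < \<bar>Y n \<omega>\<bar>} \<le> \<eta>)"

lemma vanishing_measurable: "vanishing Y \<Longrightarrow> Y n \<in> borel_measurable M"
  and bounded_in_prob_measurable: "bounded_in_prob Y \<Longrightarrow> Y n \<in> borel_measurable M"
  by (auto simp: vanishing_def bounded_in_prob_def)

lemma vanishingD: "vanishing Y \<Longrightarrow> 0 < \<delta> \<Longrightarrow> (\<lambda>n. prob {\<omega> \<in> space M. \<delta> < \<bar>Y n \<omega>\<bar>}) \<longlonglongrightarrow> 0"
  by (simp add: vanishing_def)

lemma bounded_in_probE:
  assumes "bounded_in_prob Y" "0 < \<eta>"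
  obtains K where "0 < K" "\<And>n. prob {\<omega> \<in> space M. K < \<bar>Y n \<omega>\<bar>} \<le> \<eta>"
  using assms unfolding bounded_in_prob_def by blast

lemma vanishingI:
  assumes "\<And>n. Y n \<in> borel_measurable M"
    and "\<And>\<delta>. 0 < \<delta> \<Longrightarrow> \<exists>p. p \<longlonglongrightarrow> 0 \<and> (\<forall>n. prob {\<omega> \<in> space M. \<delta> < \<bar>Y n \<omega>\<bar>} \<le> p n)"
  shows "vanishing Y"
  unfolding vanishing_def
proof (intro conjI allI impI)
  fix \<delta> :: real assume "0 < \<delta>"
  then obtain p where p: "p \<longlonglongrightarrow> 0" "\<And>n. prob {\<omega> \<in> space M. \<delta> < \<bar>Y n \<omega>\<bar>} \<le> p n"
    using assms(2) by blast
  show "(\<lambda>n. prob {\<omega> \<in> space M. \<delta> < \<bar>Y n \<omega>\<bar>}) \<longlonglongrightarrow> 0"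
    by (rule tendsto_sandwich[OF _ _ tendsto_const p(1)]) (simp_all add: p(2))
qed (fact assms(1))

lemma prob_le_two:
  assumes "\<And>\<omega>. \<omega> \<in> space M \<Longrightarrow> P \<omega> \<Longrightarrow> Q \<omega> \<or> R \<omega>"
    and "{\<omega> \<in> space M. Q \<omega>} \<in> events" "{\<omega> \<in> space M. R \<omega>} \<in> events"
  shows "prob {\<omega> \<in> space M. P \<omega>} \<le> prob {\<omega> \<in> space M. Q \<omega>} + prob {\<omega> \<in> space M. R \<omega>}"
proof -
  have "prob {\<omega> \<in> space M. P \<omega>} \<le> prob ({\<omega> \<in> space M. Q \<omega>} \<union> {\<omega> \<in> space M. R \<omega>})"
    using assms by (intro finite_measure_mono) auto
  also have "\<dots> \<le> prob {\<omega> \<in> space M. Q \<omega>} + prob {\<omega> \<in> space M. R \<omega>}"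
    using assms by (intro measure_Un_le)
  finally show ?thesis .
qed

lemma vanishing_dominated:
  assumes Z: "vanishing Z" and Y: "\<And>n. Y n \<in> borel_measurable M"
    and le: "\<And>n \<omega>. \<omega> \<in> space M \<Longrightarrow> \<bar>Y n \<omega>\<bar> \<le> \<bar>Z n \<omega>\<bar>"
  shows "vanishing Y"
proof (rule vanishingI[OF Y])
  fix \<delta> :: real assume "0 < \<delta>"
  note [measurable] = vanishing_measurable[OF Z]
  have "prob {\<omega> \<in> space M. \<delta> < \<bar>Y n \<omega>\<bar>} \<le> prob {\<omega> \<in> space M. \<delta> < \<bar>Z n \<omega>\<bar>}" for n
  proof (intro finite_measure_mono subsetI)
    fix \<omega> assume "\<omega> \<in> {\<omega> \<in> space M. \<delta> < \<bar>Y n \<omega>\<bar>}"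
    then show "\<omega> \<in> {\<omega> \<in> space M. \<delta> < \<bar>Z n \<omega>\<bar>}"
      using le[of \<omega> n] by simp
  qed measurable
  then show "\<exists>p. p \<longlonglongrightarrow> 0 \<and> (\<forall>n. prob {\<omega> \<in> space M. \<delta> < \<bar>Y n \<omega>\<bar>} \<le> p n)"
    using vanishingD[OF Z \<open>0 < \<delta>\<close>] by blast
qed

lemma bounded_in_prob_dominated:
  assumes Z: "bounded_in_prob Z" and Y: "\<And>n. Y n \<in> borel_measurable M"
    and le: "\<And>n \<omega>. \<omega> \<in> space M \<Longrightarrow> \<bar>Y n \<omega>\<bar> \<le> \<bar>Z n \<omega>\<bar>"
  shows "bounded_in_prob Y"
proof -
  note [measurable] = bounded_in_prob_measurable[OF Z]
  have "prob {\<omega> \<in> space M. K < \<bar>Y n \<omega>\<bar>} \<le> prob {\<omega> \<in> space M. K < \<bar>Z n \<omega>\<bar>}" for n K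
  proof (intro finite_measure_mono subsetI)
    fix \<omega> assume "\<omega> \<in> {\<omega> \<in> space M. K < \<bar>Y n \<omega>\<bar>}"
    then show "\<omega> \<in> {\<omega> \<in> space M. K < \<bar>Z n \<omega>\<bar>}"
      using le[of \<omega> n] by simp
  qed measurable
  note le_prob = this
  have "\<exists>K>0. \<forall>n. prob {\<omega> \<in> space M. K < \<bar>Y n \<omega>\<bar>} \<le> \<eta>" if "0 < \<eta>" for \<eta>
  proof -
    from bounded_in_probE[OF Z that] obtain K
      where "0 < K" "\<And>n. prob {\<omega> \<in> space M. K < \<bar>Z n \<omega>\<bar>} \<le> \<eta>" by blast
    then show ?thesis by (intro exI[of _ K] conjI allI order_trans[OF le_prob])
  qed
  then show ?thesis using Y by (simp add: bounded_in_prob_def)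
qed

lemma vanishing_add:
  assumes Y: "vanishing Y" and Z: "vanishing Z"
  shows "vanishing (\<lambda>n \<omega>. Y n \<omega> + Z n \<omega>)"
proof (rule vanishingI)
  note [measurable] = vanishing_measurable[OF Y] vanishing_measurable[OF Z]
  show "(\<lambda>\<omega>. Y n \<omega> + Z n \<omega>) \<in> borel_measurable M" for n by measurable
  fix \<delta> :: real assume \<delta>: "0 < \<delta>"
  have "prob {\<omega> \<in> space M. \<delta> < \<bar>Y n \<omega> + Z n \<omega>\<bar>}
      \<le> prob {\<omega> \<in> space M. \<delta> / 2 < \<bar>Y n \<omega>\<bar>} + prob {\<omega> \<in> space M. \<delta> / 2 < \<bar>Z n \<omega>\<bar>}" for n
  proof (rule prob_le_two)
    show "\<delta> / 2 < \<bar>Y n \<omega>\<bar> \<or> \<delta> / 2 < \<bar>Z n \<omega>\<bar>" if "\<delta> < \<bar>Y n \<omega> + Z n \<omega>\<bar>" for \<omega>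
      using that abs_triangle_ineq[of "Y n \<omega>" "Z n \<omega>"] by linarith
  qed measurable
  moreover have "(\<lambda>n. prob {\<omega> \<in> space M. \<delta> / 2 < \<bar>Y n \<omega>\<bar>} + prob {\<omega> \<in> space M. \<delta> / 2 < \<bar>Z n \<omega>\<bar>}) \<longlonglongrightarrow> 0 + 0"
    using \<delta> by (intro tendsto_add vanishingD[OF Y] vanishingD[OF Z]) auto
  ultimately show "\<exists>p. p \<longlonglongrightarrow> 0 \<and> (\<forall>n. prob {\<omega> \<in> space M. \<delta> < \<bar>Y n \<omega> + Z n \<omega>\<bar>} \<le> p n)"
    by (subst (asm) add_0_left) blast
qed

text \<open>
  Sums and products share this argument: outside two events of small probability both
  arguments lie in a bounded box, on which the operation is bounded.
\<close>

lemma bounded_in_prob_binop: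
  assumes Y: "bounded_in_prob Y" and Z: "bounded_in_prob Z"
    and m: "\<And>n. (\<lambda>\<omega>. f (Y n \<omega>) (Z n \<omega>)) \<in> borel_measurable M"
    and f: "\<And>K L. 0 < K \<Longrightarrow> 0 < L \<Longrightarrow> \<exists>J>0. \<forall>y z. \<bar>y\<bar> \<le> K \<longrightarrow> \<bar>z\<bar> \<le> L \<longrightarrow> \<bar>f y z\<bar> \<le> J"
  shows "bounded_in_prob (\<lambda>n \<omega>. f (Y n \<omega>) (Z n \<omega>))"
  unfolding bounded_in_prob_def
proof (intro conjI allI impI m)
  note [measurable] = bounded_in_prob_measurable[OF Y] bounded_in_prob_measurable[OF Z]
  fix \<eta> :: real assume "0 < \<eta>"
  then have "0 < \<eta> / 2" by simp
  from bounded_in_probE[OF Y this] obtain K where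
    K: "0 < K" "\<And>n. prob {\<omega> \<in> space M. K < \<bar>Y n \<omega>\<bar>} \<le> \<eta> / 2" by blast
  from bounded_in_probE[OF Z \<open>0 < \<eta> / 2\<close>] obtain L where
    L: "0 < L" "\<And>n. prob {\<omega> \<in> space M. L < \<bar>Z n \<omega>\<bar>} \<le> \<eta> / 2" by blast
  from f[OF K(1) L(1)] obtain J where J: "0 < J" "\<And>y z. \<bar>y\<bar> \<le> K \<Longrightarrow> \<bar>z\<bar> \<le> L \<Longrightarrow> \<bar>f y z\<bar> \<le> J"
    by blast
  have "prob {\<omega> \<in> space M. J < \<bar>f (Y n \<omega>) (Z n \<omega>)\<bar>} \<le> \<eta>" for n
  proof -
    have "prob {\<omega> \<in> space M. J < \<bar>f (Y n \<omega>) (Z n \<omega>)\<bar>}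
        \<le> prob {\<omega> \<in> space M. K < \<bar>Y n \<omega>\<bar>} + prob {\<omega> \<in> space M. L < \<bar>Z n \<omega>\<bar>}"
    proof (rule prob_le_two)
      show "K < \<bar>Y n \<omega>\<bar> \<or> L < \<bar>Z n \<omega>\<bar>" if "J < \<bar>f (Y n \<omega>) (Z n \<omega>)\<bar>" for \<omega>
        using J(2)[of "Y n \<omega>" "Z n \<omega>"] that by linarith
    qed measurable
    with K(2)[of n] L(2)[of n] show ?thesis by linarith
  qed
  with J(1) show "\<exists>J>0. \<forall>n. prob {\<omega> \<in> space M. J < \<bar>f (Y n \<omega>) (Z n \<omega>)\<bar>} \<le> \<eta>" by blast
qed

lemma bounded_in_prob_add:
  assumes Y: "bounded_in_prob Y" and Z: "bounded_in_prob Z"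
  shows "bounded_in_prob (\<lambda>n \<omega>. Y n \<omega> + Z n \<omega>)"
proof (rule bounded_in_prob_binop[OF Y Z])
  note [measurable] = bounded_in_prob_measurable[OF Y] bounded_in_prob_measurable[OF Z]
  show "(\<lambda>\<omega>. Y n \<omega> + Z n \<omega>) \<in> borel_measurable M" for n by measurable
  show "\<exists>J>0. \<forall>y z. \<bar>y\<bar> \<le> K \<longrightarrow> \<bar>z\<bar> \<le> L \<longrightarrow> \<bar>y + z\<bar> \<le> J" if "0 < K" "0 < L" for K L :: real
    using that by (intro exI[of _ "K + L"]) auto
qed

lemma bounded_in_prob_mult:
  assumes Y: "bounded_in_prob Y" and Z: "bounded_in_prob Z"
  shows "bounded_in_prob (\<lambda>n \<omega>. Y n \<omega> * Z n \<omega>)"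
proof (rule bounded_in_prob_binop[OF Y Z])
  note [measurable] = bounded_in_prob_measurable[OF Y] bounded_in_prob_measurable[OF Z]
  show "(\<lambda>\<omega>. Y n \<omega> * Z n \<omega>) \<in> borel_measurable M" for n by measurable
  show "\<exists>J>0. \<forall>y z. \<bar>y\<bar> \<le> K \<longrightarrow> \<bar>z\<bar> \<le> L \<longrightarrow> \<bar>y * z\<bar> \<le> J" if "0 < K" "0 < L" for K L :: real
    using that by (intro exI[of _ "K * L"]) (auto simp: abs_mult intro!: mult_mono)
qed

text \<open>
  The factor that is bounded in probability exceeds a suitable constant only with small
  probability, and against a constant the vanishing factor wins.
\<close>

lemma vanishing_mult:
  assumes Y: "vanishing Y" and Z: "bounded_in_prob Z"
  shows "vanishing (\<lambda>n \<omega>. Y n \<omega> * Z n \<omega>)"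
  unfolding vanishing_def
proof (intro conjI allI impI)
  note [measurable] = vanishing_measurable[OF Y] bounded_in_prob_measurable[OF Z]
  show "(\<lambda>\<omega>. Y n \<omega> * Z n \<omega>) \<in> borel_measurable M" for n by measurable
  fix \<delta> :: real assume \<delta>: "0 < \<delta>"
  show "(\<lambda>n. prob {\<omega> \<in> space M. \<delta> < \<bar>Y n \<omega> * Z n \<omega>\<bar>}) \<longlonglongrightarrow> 0"
  proof (rule LIMSEQ_I)
    fix \<eta> :: real assume "0 < \<eta>"
    then have "0 < \<eta> / 2" by simp
    from bounded_in_probE[OF Z this] obtain K where
      K: "0 < K" "\<And>n. prob {\<omega> \<in> space M. K < \<bar>Z n \<omega>\<bar>} \<le> \<eta> / 2" by blast
    have "0 < \<delta> / K" using \<delta> K by simp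
    with Y have "(\<lambda>n. prob {\<omega> \<in> space M. \<delta> / K < \<bar>Y n \<omega>\<bar>}) \<longlonglongrightarrow> 0"
      by (rule vanishingD)
    from LIMSEQ_D[OF this \<open>0 < \<eta> / 2\<close>] obtain N where
      N: "\<And>n. N \<le> n \<Longrightarrow> prob {\<omega> \<in> space M. \<delta> / K < \<bar>Y n \<omega>\<bar>} < \<eta> / 2" by auto
    have "prob {\<omega> \<in> space M. \<delta> < \<bar>Y n \<omega> * Z n \<omega>\<bar>} < \<eta>" if "N \<le> n" for n
    proof -
      have "prob {\<omega> \<in> space M. \<delta> < \<bar>Y n \<omega> * Z n \<omega>\<bar>}
          \<le> prob {\<omega> \<in> space M. \<delta> / K < \<bar>Y n \<omega>\<bar>} + prob {\<omega> \<in> space M. K < \<bar>Z n \<omega>\<bar>}"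
      proof (rule prob_le_two)
        show "\<delta> / K < \<bar>Y n \<omega>\<bar> \<or> K < \<bar>Z n \<omega>\<bar>" if a: "\<delta> < \<bar>Y n \<omega> * Z n \<omega>\<bar>" for \<omega>
        proof (rule ccontr)
          assume "\<not> ?thesis"
          then have "\<bar>Y n \<omega>\<bar> * \<bar>Z n \<omega>\<bar> \<le> \<delta> / K * K" using \<delta> K by (intro mult_mono) auto
          with a K show False by (simp add: abs_mult)
        qed
      qed measurable
      with N[OF that] K(2)[of n] show ?thesis by linarith
    qed
    then show "\<exists>N. \<forall>n\<ge>N. norm (prob {\<omega> \<in> space M. \<delta> < \<bar>Y n \<omega> * Z n \<omega>\<bar>} - 0) < \<eta>" by auto
  qed
qed

lemma vanishing_const: "c \<longlonglongrightarrow> 0 \<Longrightarrow> vanishing (\<lambda>n \<omega>. c n)"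
proof -
  assume c: "c \<longlonglongrightarrow> 0"
  have "(\<lambda>n. prob {\<omega> \<in> space M. \<delta> < \<bar>c n\<bar>}) \<longlonglongrightarrow> 0" if "0 < \<delta>" for \<delta>
  proof (rule tendsto_eventually)
    have "\<forall>\<^sub>F n in sequentially. \<bar>c n\<bar> < \<delta>"
      using order_tendstoD(2)[OF tendsto_rabs[OF c], of \<delta>] that by simp
    then show "\<forall>\<^sub>F n in sequentially. prob {\<omega> \<in> space M. \<delta> < \<bar>c n\<bar>} = 0"
      by eventually_elim simp
  qed
  then show ?thesis by (simp add: vanishing_def)
qed

text \<open>
  A single real random variable is tight because the events \<open>n < \<bar>W\<bar>\<close> decrease to the empty
  set. This is what makes arbitrary initial values harmless.
\<close>

lemma bounded_in_prob_const:
  fixes W :: "'a \<Rightarrow> real"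
  assumes [measurable]: "W \<in> borel_measurable M"
  shows "bounded_in_prob (\<lambda>n. W)"
proof -
  have "\<exists>K>0. prob {\<omega> \<in> space M. K < \<bar>W \<omega>\<bar>} \<le> \<eta>" if \<eta>: "0 < \<eta>" for \<eta>
  proof -
    define A where "A n = {\<omega> \<in> space M. real n < \<bar>W \<omega>\<bar>}" for n
    have "(\<lambda>n. prob (A n)) \<longlonglongrightarrow> prob (\<Inter>n. A n)"
      by (rule finite_Lim_measure_decseq) (auto simp: A_def decseq_def)
    also have "(\<Inter>n. A n) = {}"
    proof -
      have "\<exists>n. \<bar>W \<omega>\<bar> \<le> real n" for \<omega> by (rule real_arch_simple)
      then show ?thesis by (force simp: A_def not_less[symmetric])
    qed
    finally have "(\<lambda>n. prob (A n)) \<longlonglongrightarrow> 0" by simp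
    from LIMSEQ_D[OF this \<eta>] obtain N where "\<And>n. N \<le> n \<Longrightarrow> prob (A n) < \<eta>" by auto
    from this[of "Suc N"] show ?thesis
      by (intro exI[of _ "real (Suc N)"]) (auto simp: A_def)
  qed
  then show ?thesis by (simp add: bounded_in_prob_def)
qed

lemma markov_inequality_abs:
  assumes "integrable M (Y :: 'a \<Rightarrow> real)" "0 < \<delta>"
  shows "prob {\<omega> \<in> space M. \<delta> < \<bar>Y \<omega>\<bar>} \<le> expectation (\<lambda>\<omega>. \<bar>Y \<omega>\<bar>) / \<delta>"
proof -
  have [measurable]: "Y \<in> borel_measurable M" using assms(1) by simp
  have "prob {\<omega> \<in> space M. \<delta> < \<bar>Y \<omega>\<bar>} \<le> prob {\<omega> \<in> space M. \<delta> \<le> \<bar>Y \<omega>\<bar>}"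
    by (intro finite_measure_mono) auto
  also have "\<dots> \<le> expectation (\<lambda>\<omega>. \<bar>Y \<omega>\<bar>) / \<delta>"
    using assms by (intro integral_Markov_inequality_measure[of _ _ "{}"]) auto
  finally show ?thesis .
qed

lemma bounded_in_prob_of_mean:
  assumes i: "\<And>n. integrable M (Y n)" and b: "\<And>n. expectation (\<lambda>\<omega>. \<bar>Y n \<omega>\<bar>) \<le> c"
  shows "bounded_in_prob Y"
proof -
  have "\<exists>K>0. \<forall>n. prob {\<omega> \<in> space M. K < \<bar>Y n \<omega>\<bar>} \<le> \<eta>" if \<eta>: "0 < \<eta>" for \<eta>
  proof -
    \<comment> \<open>The summand 1 makes \<open>K\<close> positive also when \<open>c = 0\<close>.\<close>
    define K where "K = (\<bar>c\<bar> + 1) / \<eta>"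
    have K: "0 < K" using \<eta> by (simp add: K_def)
    have "prob {\<omega> \<in> space M. K < \<bar>Y n \<omega>\<bar>} \<le> \<eta>" for n
    proof -
      have "prob {\<omega> \<in> space M. K < \<bar>Y n \<omega>\<bar>} \<le> expectation (\<lambda>\<omega>. \<bar>Y n \<omega>\<bar>) / K"
        by (rule markov_inequality_abs[OF i K])
      also have "\<dots> \<le> (\<bar>c\<bar> + 1) / K" using b[of n] K by (intro divide_right_mono) auto
      also have "\<dots> = \<eta>" using \<eta> by (simp add: K_def)
      finally show ?thesis .
    qed
    with K show ?thesis by blast
  qed
  then show ?thesis using i by (auto simp: bounded_in_prob_def)
qed

lemma vanishing_of_mean_square:
  assumes [measurable]: "\<And>n. Y n \<in> borel_measurable M"
    and i: "\<And>n. integrable M (\<lambda>\<omega>. (Y n \<omega>)\<^sup>2)" and l: "(\<lambda>n. expectation (\<lambda>\<omega>. (Y n \<omega>)\<^sup>2)) \<longlonglongrightarrow> 0"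
  shows "vanishing Y"
proof (rule vanishingI)
  fix \<delta> :: real assume \<delta>: "0 < \<delta>"
  have "prob {\<omega> \<in> space M. \<delta> < \<bar>Y n \<omega>\<bar>} \<le> expectation (\<lambda>\<omega>. (Y n \<omega>)\<^sup>2) / \<delta>\<^sup>2" for n
  proof -
    have "\<delta>\<^sup>2 < \<bar>(Y n \<omega>)\<^sup>2\<bar>" if "\<delta> < \<bar>Y n \<omega>\<bar>" for \<omega>
      using power_strict_mono[OF that, of 2] \<delta> by simp
    then have "prob {\<omega> \<in> space M. \<delta> < \<bar>Y n \<omega>\<bar>} \<le> prob {\<omega> \<in> space M. \<delta>\<^sup>2 < \<bar>(Y n \<omega>)\<^sup>2\<bar>}"
      by (intro finite_measure_mono) auto
    also have "\<dots> \<le> expectation (\<lambda>\<omega>. \<bar>(Y n \<omega>)\<^sup>2\<bar>) / \<delta>\<^sup>2"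
      using \<delta> by (intro markov_inequality_abs i) simp
    finally show ?thesis by simp
  qed
  moreover have "(\<lambda>n. expectation (\<lambda>\<omega>. (Y n \<omega>)\<^sup>2) / \<delta>\<^sup>2) \<longlonglongrightarrow> 0"
    using tendsto_divide[OF l tendsto_const[of "\<delta>\<^sup>2"]] \<delta> by simp
  ultimately show "\<exists>p. p \<longlonglongrightarrow> 0 \<and> (\<forall>n. prob {\<omega> \<in> space M. \<delta> < \<bar>Y n \<omega>\<bar>} \<le> p n)" by blast
qed simp

text \<open>
  Inversion is continuous at the positive limit. That the inverse of zero is zero does no
  harm, since a zero value is at distance \<open>r\<close> from the limit.
\<close>

lemma vanishing_inverse:
  assumes R: "vanishing (\<lambda>n \<omega>. R n \<omega> - r)" and r: "0 < r"
    and [measurable]: "\<And>n. R n \<in> borel_measurable M"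
  shows "vanishing (\<lambda>n \<omega>. inverse (R n \<omega>) - inverse r)"
proof (rule vanishingI)
  fix \<delta> :: real assume \<delta>: "0 < \<delta>"
  define \<eta> where "\<eta> = min (r / 2) (\<delta> * r\<^sup>2 / 2)"
  have \<eta>: "0 < \<eta>" using r \<delta> by (simp add: \<eta>_def)
  have close: "\<bar>inverse y - inverse r\<bar> \<le> \<delta>" if "\<bar>y - r\<bar> \<le> \<eta>" for y
  proof -
    have "\<bar>y - r\<bar> \<le> r / 2" using that by (simp add: \<eta>_def)
    then have y: "r / 2 \<le> y" by linarith
    then have "0 < y" using r by linarith
    have "\<bar>inverse y - inverse r\<bar> = \<bar>y - r\<bar> / (y * r)"
      using r \<open>0 < y\<close> by (simp add: inverse_eq_divide divide_simps abs_mult)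
    also have "\<dots> \<le> (\<delta> * r\<^sup>2 / 2) / (r / 2 * r)"
      using that r y \<delta> by (intro frac_le mult_right_mono mult_pos_pos) (auto simp: \<eta>_def)
    also have "\<dots> = \<delta>" using r by (simp add: power2_eq_square)
    finally show ?thesis .
  qed
  have "prob {\<omega> \<in> space M. \<delta> < \<bar>inverse (R n \<omega>) - inverse r\<bar>} \<le> prob {\<omega> \<in> space M. \<eta> < \<bar>R n \<omega> - r\<bar>}" for n
  proof (intro finite_measure_mono subsetI)
    fix \<omega> assume "\<omega> \<in> {\<omega> \<in> space M. \<delta> < \<bar>inverse (R n \<omega>) - inverse r\<bar>}"
    then show "\<omega> \<in> {\<omega> \<in> space M. \<eta> < \<bar>R n \<omega> - r\<bar>}"
      using close[of "R n \<omega>"] by force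
  qed measurable
  then show "\<exists>p. p \<longlonglongrightarrow> 0 \<and> (\<forall>n. prob {\<omega> \<in> space M. \<delta> < \<bar>inverse (R n \<omega>) - inverse r\<bar>} \<le> p n)"
    using vanishingD[OF R \<eta>] by blast
qed measurable

text \<open>
  The part of Slutsky's theorem that concerns sums, for characteristic functions: two unit
  phases differ by at most \<open>\<bar>t\<bar> \<delta>\<close> where the random variables are \<open>\<delta>\<close>-close, and by at most 2 elsewhere.
\<close>

lemma char_limit_of_vanishing_difference:
  assumes d: "vanishing (\<lambda>n \<omega>. Q n \<omega> - T n \<omega>)"
    and [measurable]: "\<And>n. Q n \<in> borel_measurable M" "\<And>n. T n \<in> borel_measurable M"
    and T: "(\<lambda>n. expectation (\<lambda>\<omega>. iexp (t * T n \<omega>))) \<longlonglongrightarrow> c"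
  shows "(\<lambda>n. expectation (\<lambda>\<omega>. iexp (t * Q n \<omega>))) \<longlonglongrightarrow> c"
proof -
  have int: "integrable M (\<lambda>\<omega>. iexp (t * Y \<omega>))" if [measurable]: "Y \<in> borel_measurable M" for Y
    by (rule integrable_const_bound[of _ 1]) simp_all
  have pt: "norm (iexp (t * q) - iexp (t * u)) \<le> \<bar>t\<bar> * \<delta> + 2 * indicator {y. \<delta> < \<bar>y\<bar>} (q - u)"
    if "0 < \<delta>" for q u \<delta> :: real
  proof (cases "\<delta> < \<bar>q - u\<bar>")
    case True
    have "norm (iexp (t * q) - iexp (t * u)) \<le> norm (iexp (t * q)) + norm (iexp (t * u))"
      by (rule norm_triangle_ineq4)
    then show ?thesis using True that by (simp add: add_increasing)
  next
    case False
    have "iexp (t * q) - iexp (t * u) = iexp (t * u) * (iexp (t * (q - u)) - (\<Sum>j\<le>0. (\<i> * (t * (q - u))) ^ j / fact j))"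
      by (simp add: algebra_simps flip: exp_add)
    then have "norm (iexp (t * q) - iexp (t * u)) \<le> \<bar>t * (q - u)\<bar> ^ Suc 0 / fact (Suc 0)"
      using iexp_approx1[of "t * (q - u)" 0] by (simp add: norm_mult)
    also have "\<dots> \<le> \<bar>t\<bar> * \<delta>" using False by (auto simp: abs_mult intro!: mult_left_mono)
    finally show ?thesis using False by simp
  qed
  have "(\<lambda>n. expectation (\<lambda>\<omega>. iexp (t * Q n \<omega>)) - expectation (\<lambda>\<omega>. iexp (t * T n \<omega>))) \<longlonglongrightarrow> 0"
  proof (rule LIMSEQ_I)
    fix \<eta> :: real assume \<eta>: "0 < \<eta>"
    \<comment> \<open>The summand 1 keeps the denominator positive at \<open>t = 0\<close>.\<close>
    define \<delta> where "\<delta> = \<eta> / (2 * (\<bar>t\<bar> + 1))"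
    have \<delta>: "0 < \<delta>" using \<eta> by (simp add: \<delta>_def)
    have t\<delta>: "\<bar>t\<bar> * \<delta> \<le> \<eta> / 2" using \<eta> by (simp add: \<delta>_def field_simps)
    from d \<delta> have "(\<lambda>n. prob {\<omega> \<in> space M. \<delta> < \<bar>Q n \<omega> - T n \<omega>\<bar>}) \<longlonglongrightarrow> 0"
      by (rule vanishingD)
    from LIMSEQ_D[OF this, of "\<eta> / 4"] \<eta> obtain N where
      N: "\<And>n. N \<le> n \<Longrightarrow> prob {\<omega> \<in> space M. \<delta> < \<bar>Q n \<omega> - T n \<omega>\<bar>} < \<eta> / 4" by auto
    have "norm (expectation (\<lambda>\<omega>. iexp (t * Q n \<omega>)) - expectation (\<lambda>\<omega>. iexp (t * T n \<omega>))) < \<eta>"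
      if "N \<le> n" for n
    proof -
      define A where "A = {\<omega> \<in> space M. \<delta> < \<bar>Q n \<omega> - T n \<omega>\<bar>}"
      have A: "A \<in> events" unfolding A_def by measurable
      have "expectation (\<lambda>\<omega>. iexp (t * Q n \<omega>)) - expectation (\<lambda>\<omega>. iexp (t * T n \<omega>))
          = expectation (\<lambda>\<omega>. iexp (t * Q n \<omega>) - iexp (t * T n \<omega>))"
        by (intro Bochner_Integration.integral_diff[symmetric] int) measurable
      also have "norm \<dots> \<le> expectation (\<lambda>\<omega>. norm (iexp (t * Q n \<omega>) - iexp (t * T n \<omega>)))"
        by (rule integral_norm_bound)
      also have "\<dots> \<le> expectation (\<lambda>\<omega>. \<bar>t\<bar> * \<delta> + 2 * indicator A \<omega>)"
      proof (intro integral_mono integrable_norm Bochner_Integration.integrable_diff int)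
        show "integrable M (\<lambda>\<omega>. \<bar>t\<bar> * \<delta> + 2 * indicator A \<omega>)"
          by (intro Bochner_Integration.integrable_add integrable_mult_right integrable_const
              integrable_real_indicator A) (simp add: emeasure_eq_measure)
        show "norm (iexp (t * Q n \<omega>) - iexp (t * T n \<omega>)) \<le> \<bar>t\<bar> * \<delta> + 2 * indicator A \<omega>"
          if "\<omega> \<in> space M" for \<omega>
          using pt[OF \<delta>, of "Q n \<omega>" "T n \<omega>"] that by (simp add: A_def indicator_def)
      qed measurable
      also have "\<dots> = \<bar>t\<bar> * \<delta> + 2 * prob A"
        by (subst Bochner_Integration.integral_add)
           (simp_all add: prob_space A emeasure_eq_measure integrable_real_indicator)
      also have "\<dots> < \<eta>" using t\<delta> N[OF that] by (simp add: A_def)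
      finally show ?thesis .
    qed
    then show "\<exists>N. \<forall>n\<ge>N. norm (expectation (\<lambda>\<omega>. iexp (t * Q n \<omega>)) - expectation (\<lambda>\<omega>. iexp (t * T n \<omega>)) - 0) < \<eta>"
      by auto
  qed
  from tendsto_add[OF this T] show ?thesis by simp
qed

end

section \<open>Centered independent noise and its past\<close>

lemma integrable_mult_of_squares:
  fixes f g :: "'a \<Rightarrow> real"
  assumes [measurable]: "f \<in> borel_measurable M" "g \<in> borel_measurable M"
    and "integrable M (\<lambda>\<omega>. (f \<omega>)\<^sup>2)" "integrable M (\<lambda>\<omega>. (g \<omega>)\<^sup>2)"
  shows "integrable M (\<lambda>\<omega>. f \<omega> * g \<omega>)"
proof (rule Bochner_Integration.integrable_bound)
  show "integrable M (\<lambda>\<omega>. (f \<omega>)\<^sup>2 + (g \<omega>)\<^sup>2)"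
    using assms by simp
  have "\<bar>a * b\<bar> \<le> a\<^sup>2 + b\<^sup>2" for a b :: real
    using sum_squares_bound[of "\<bar>a\<bar>" "\<bar>b\<bar>"] mult_nonneg_nonneg[of "\<bar>a\<bar>" "\<bar>b\<bar>"]
    by (simp only: abs_mult power2_abs) linarith
  then show "AE \<omega> in M. norm (f \<omega> * g \<omega>) \<le> norm ((f \<omega>)\<^sup>2 + (g \<omega>)\<^sup>2)"
    by simp
qed simp

lemma abs_le_one_plus_square: "\<bar>a\<bar> \<le> 1 + a\<^sup>2" for a :: real
  using sum_squares_bound[of "\<bar>a\<bar>" 1] by auto

lemma square_le_one_plus_fourth: "a\<^sup>2 \<le> 1 + a ^ 4" for a :: real
  using abs_le_one_plus_square[of "a\<^sup>2"] by simp

lemma abs_cube_le_one_plus_fourth: "\<bar>a\<bar> ^ 3 \<le> 1 + a ^ 4" for a :: real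
proof (cases "\<bar>a\<bar> \<le> 1")
  case True
  then have "\<bar>a\<bar> ^ 3 \<le> 1" by (simp add: power_le_one)
  then show ?thesis by (smt (verit) zero_le_even_power[of 4 a] even_numeral)
next
  case False
  then have "\<bar>a\<bar> ^ 3 \<le> \<bar>a\<bar> ^ 4" by (intro power_increasing) auto
  then show ?thesis by simp
qed

lemma norm_integral_le:
  fixes f :: "'a \<Rightarrow> 'b::{banach,second_countable_topology}"
  assumes "integrable M f" "integrable M g" "\<And>\<omega>. norm (f \<omega>) \<le> g \<omega>"
  shows "norm (integral\<^sup>L M f) \<le> integral\<^sup>L M g"
proof -
  have "norm (integral\<^sup>L M f) \<le> (\<integral>\<omega>. norm (f \<omega>) \<partial>M)" by (rule integral_norm_bound)
  also have "\<dots> \<le> integral\<^sup>L M g" using assms by (intro integral_mono) auto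
  finally show ?thesis .
qed

text \<open>
  One-step errors of an affine recursion with factor in \<open>[0, 1]\<close> are never amplified, so
  they add up at most linearly.
\<close>

lemma affine_recursion_deviation:
  fixes z :: "nat \<Rightarrow> complex" and q d :: real
  assumes "0 \<le> q" "q \<le> 1"
    and step: "\<And>k. norm (z (Suc k) - of_real q * z k) \<le> d"
  shows "norm (z n - of_real (q ^ n) * z 0) \<le> real n * d"
proof (induction n)
  case (Suc n)
  have "z (Suc n) - of_real (q ^ Suc n) * z 0
      = (z (Suc n) - of_real q * z n) + of_real q * (z n - of_real (q ^ n) * z 0)"
    by (simp add: algebra_simps)
  then have "norm (z (Suc n) - of_real (q ^ Suc n) * z 0)
      \<le> norm (z (Suc n) - of_real q * z n) + q * norm (z n - of_real (q ^ n) * z 0)"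
    using \<open>0 \<le> q\<close> by (metis norm_triangle_ineq norm_mult norm_of_real abs_of_nonneg)
  also have "\<dots> \<le> d + 1 * (real n * d)"
    using assms Suc by (intro add_mono mult_mono) auto
  finally show ?case by (simp add: algebra_simps)
qed simp

text \<open>
  Indices of the noise start at 1, whence \<open>V (Suc n)\<close> throughout: it is the innovation of the
  step from \<open>n\<close> to \<open>n + 1\<close>.
\<close>

locale centered_noise = prob_space M for M :: "'a measure" +
  fixes V :: "nat \<Rightarrow> 'a \<Rightarrow> real" and \<sigma> C\<^sub>V :: real
  assumes indep_V: "indep_vars (\<lambda>_. borel) V {1..}"
    and mean_V: "\<And>n. expectation (V (Suc n)) = 0"
    and square_V: "\<And>n. expectation (\<lambda>\<omega>. (V (Suc n) \<omega>)\<^sup>2) = \<sigma>\<^sup>2"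
    and integrable_V4: "\<And>n. integrable M (\<lambda>\<omega>. V (Suc n) \<omega> ^ 4)"
    and bound_V4: "\<And>n. expectation (\<lambda>\<omega>. V (Suc n) \<omega> ^ 4) \<le> C\<^sub>V"
begin

lemma measurable_V [measurable]: "V (Suc n) \<in> borel_measurable M"
  using indep_V by (auto simp: indep_vars_def2)

lemma integrable_V2: "integrable M (\<lambda>\<omega>. (V (Suc n) \<omega>)\<^sup>2)"
  by (rule Bochner_Integration.integrable_bound[of _ "\<lambda>\<omega>. 1 + V (Suc n) \<omega> ^ 4"])
     (use integrable_V4 square_le_one_plus_fourth in auto)

lemma integrable_V: "integrable M (V (Suc n))"
  by (rule square_integrable_imp_integrable[OF _ integrable_V2]) simp

definition past :: "nat \<Rightarrow> 'a measure" where
  "past n = vimage_algebra (space M) (\<lambda>\<omega>. restrict (\<lambda>i. V i \<omega>) {1..n}) (PiM {1..n} (\<lambda>_. borel))"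

lemma space_past [simp]: "space (past n) = space M"
  by (simp add: past_def)

lemma measurable_restrict_V:
  "(\<lambda>\<omega>. restrict (\<lambda>i. V i \<omega>) {1..n}) \<in> measurable N (PiM {1..n} (\<lambda>_. borel))"
  if "\<And>i. i < n \<Longrightarrow> V (Suc i) \<in> borel_measurable N"
proof (rule measurable_restrict)
  fix i assume "i \<in> {1..n}"
  then show "V i \<in> borel_measurable N" using that[of "i - 1"] by auto
qed

lemma subalgebra_past: "subalgebra M (past n)"
proof -
  have "sets (past n) \<subseteq> sets M"
    unfolding past_def by (intro sets_image_in_sets measurable_restrict_V) auto
  then show ?thesis by (simp add: subalgebra_def)
qed

lemma V_past: "i < n \<Longrightarrow> V (Suc i) \<in> borel_measurable (past n)"
proof -
  assume i: "i < n"
  have "(\<lambda>\<omega>. restrict (\<lambda>i. V i \<omega>) {1..n}) \<in> measurable (past n) (PiM {1..n} (\<lambda>_. borel))"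
    unfolding past_def by (rule measurable_vimage_algebra1) (auto simp: space_PiM)
  from measurable_compose[OF this measurable_component_singleton[of "Suc i"]] i
  show ?thesis by simp
qed

lemma subalgebra_past_Suc: "subalgebra (past (Suc n)) (past n)"
proof -
  have "sets (past n) \<subseteq> sets (past (Suc n))"
    by (subst past_def, intro sets_image_in_sets measurable_restrict_V) (auto intro: V_past)
  then show ?thesis by (simp add: subalgebra_def)
qed

lemmas measurable_from_past = measurable_from_subalg[OF subalgebra_past]
lemmas measurable_past_Suc = measurable_from_subalg[OF subalgebra_past_Suc]

text \<open>
  A function measurable with respect to the past is independent of the next noise variable,
  because the blocks \<open>{1..n}\<close> and \<open>{n + 1}\<close> of indices are disjoint.
\<close>

lemma indep_past:
  fixes f :: "'a \<Rightarrow> 'b::topological_space" and g :: "real \<Rightarrow> 'b"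
  assumes f: "f \<in> borel_measurable (past n)" and [measurable]: "g \<in> borel_measurable borel"
  shows "indep_var borel f borel (\<lambda>\<omega>. g (V (Suc n) \<omega>))"
proof -
  define R where "R = (\<lambda>\<omega>. restrict (\<lambda>i. V i \<omega>) {1..n})"
  define P where "P = PiM {1..n} (\<lambda>_. borel :: real measure)"
  define R' where "R' = (\<lambda>\<omega>. restrict (\<lambda>i. V i \<omega>) {Suc n})"
  define P' where "P' = PiM {Suc n} (\<lambda>_. borel :: real measure)"
  have "indep_var P R P' R'"
    unfolding P_def R_def P'_def R'_def by (rule indep_var_restrict[OF indep_V]) auto
  then have 1: "indep_set (sigma_sets (space M) {R -` A \<inter> space M |A. A \<in> sets P})
      (sigma_sets (space M) {R' -` A \<inter> space M |A. A \<in> sets P'})"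
    and R: "R \<in> measurable M P"
    by (auto simp: indep_var_eq)
  have 3: "{(\<lambda>\<omega>. g (V (Suc n) \<omega>)) -` A \<inter> space M |A. A \<in> sets borel}
      \<subseteq> {R' -` A \<inter> space M |A. A \<in> sets P'}"
  proof safe
    fix A :: "'b set" assume A: "A \<in> sets borel"
    define B where "B = (\<lambda>h. g (h (Suc n))) -` A \<inter> space P'"
    have "(\<lambda>h. g (h (Suc n))) \<in> borel_measurable P'"
      unfolding P'_def by measurable
    then have "B \<in> sets P'" unfolding B_def using A by (rule measurable_sets)
    moreover have "(\<lambda>\<omega>. g (V (Suc n) \<omega>)) -` A \<inter> space M = R' -` B \<inter> space M"
      by (auto simp: B_def R'_def P'_def space_PiM)
    ultimately show "\<exists>B. (\<lambda>\<omega>. g (V (Suc n) \<omega>)) -` A \<inter> space M = R' -` B \<inter> space M \<and> B \<in> sets P'"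
      by blast
  qed
  have 2: "{f -` A \<inter> space M |A. A \<in> sets borel} \<subseteq> {R -` A \<inter> space M |A. A \<in> sets P}"
  proof safe
    fix A :: "'b set" assume "A \<in> sets borel"
    then have "f -` A \<inter> space M \<in> sets (past n)"
      using measurable_sets[OF f] by simp
    also have "sets (past n) = {R -` A \<inter> space M |A. A \<in> sets P}"
      unfolding past_def R_def[symmetric] P_def[symmetric]
      using R by (intro sets_vimage_algebra2) (auto simp: measurable_def)
    finally show "\<exists>B. f -` A \<inter> space M = R -` B \<inter> space M \<and> B \<in> sets P" by auto
  qed
  show ?thesis
    unfolding indep_var_eq
  proof (intro conjI)
    show "f \<in> borel_measurable M" using f by (rule measurable_from_past)
    show "indep_set (sigma_sets (space M) {f -` A \<inter> space M |A. A \<in> sets borel})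
      (sigma_sets (space M) {(\<lambda>\<omega>. g (V (Suc n) \<omega>)) -` A \<inter> space M |A. A \<in> sets borel})"
      using 1 subsetD[OF sigma_sets_mono'[OF 2]] subsetD[OF sigma_sets_mono'[OF 3]]
      unfolding indep_sets2_eq subset_iff by (metis (lifting))
  qed simp
qed

text \<open>
  The substitute for conditional expectations: a factor from the past can be averaged
  separately from a function of the next noise variable.
\<close>

lemma
  fixes f :: "'a \<Rightarrow> 'b::{real_normed_field,banach,second_countable_topology}"
  assumes f: "f \<in> borel_measurable (past n)" "integrable M f"
    and [measurable]: "g \<in> borel_measurable borel" and g: "integrable M (\<lambda>\<omega>. g (V (Suc n) \<omega>))"
  shows integrable_past_mult: "integrable M (\<lambda>\<omega>. f \<omega> * of_real (g (V (Suc n) \<omega>)))"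
    and expectation_past_mult: "expectation (\<lambda>\<omega>. f \<omega> * of_real (g (V (Suc n) \<omega>)))
      = expectation f * of_real (expectation (\<lambda>\<omega>. g (V (Suc n) \<omega>)))"
proof -
  have ind: "indep_var borel f borel (\<lambda>\<omega>. of_real (g (V (Suc n) \<omega>)) :: 'b)"
    using indep_past[OF f(1), of "\<lambda>v. of_real (g v)"] by simp
  have int: "integrable M (\<lambda>\<omega>. of_real (g (V (Suc n) \<omega>)) :: 'b)"
    using g by (rule integrable_of_real)
  show "integrable M (\<lambda>\<omega>. f \<omega> * of_real (g (V (Suc n) \<omega>)))"
    by (rule indep_var_integrable[OF ind f(2) int])
  show "expectation (\<lambda>\<omega>. f \<omega> * of_real (g (V (Suc n) \<omega>)))
      = expectation f * of_real (expectation (\<lambda>\<omega>. g (V (Suc n) \<omega>)))"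
    using indep_var_lebesgue_integral[OF ind f(2) int]
    unfolding integral_bounded_linear[OF bounded_linear_of_real g] .
qed

text \<open>
  The summands are orthogonal martingale differences, so second moments grow linearly. Both
  kinds of summands that occur are covered: the linear one drives the central limit theorem,
  the centered square comes from the corrector.
\<close>

lemma martingale_second_moment:
  fixes p :: "nat \<Rightarrow> 'a \<Rightarrow> real" and \<kappa> C :: real and n :: nat
  assumes p_past: "\<And>k. p k \<in> borel_measurable (past k)"
    and p2: "\<And>k. integrable M (\<lambda>\<omega>. (p k \<omega>)\<^sup>2)"
    and bp: "\<And>k. expectation (\<lambda>\<omega>. (p k \<omega>)\<^sup>2) \<le> C"
  defines "T \<equiv> \<lambda>n \<omega>. \<Sum>k<n. p k \<omega> * V (Suc k) \<omega> + \<kappa> * ((V (Suc k) \<omega>)\<^sup>2 - \<sigma>\<^sup>2)"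
  shows "T n \<in> borel_measurable (past n)"
    and "integrable M (\<lambda>\<omega>. (T n \<omega>)\<^sup>2)"
    and "expectation (\<lambda>\<omega>. (T n \<omega>)\<^sup>2) \<le> real n * (2 * C * \<sigma>\<^sup>2 + 2 * \<kappa>\<^sup>2 * (C\<^sub>V + \<sigma> ^ 4))"
proof -
  define B where "B = 2 * C * \<sigma>\<^sup>2 + 2 * \<kappa>\<^sup>2 * (C\<^sub>V + \<sigma> ^ 4)"
  have [measurable]: "p k \<in> borel_measurable M" for k
    using p_past by (rule measurable_from_past)
  have ip: "integrable M (p k)" for k
    by (rule square_integrable_imp_integrable[OF _ p2]) simp
  have cen: "integrable M (\<lambda>\<omega>. (V (Suc n) \<omega>)\<^sup>2 - \<sigma>\<^sup>2)"
    "expectation (\<lambda>\<omega>. (V (Suc n) \<omega>)\<^sup>2 - \<sigma>\<^sup>2) = 0" for n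
    using integrable_V2 by (simp_all add: square_V prob_space)
  have "T n \<in> borel_measurable (past n) \<and> integrable M (\<lambda>\<omega>. (T n \<omega>)\<^sup>2)
    \<and> expectation (\<lambda>\<omega>. (T n \<omega>)\<^sup>2) \<le> real n * B"
  proof (induction n)
    case 0
    then show ?case by (simp add: T_def[abs_def])
  next
    case (Suc n)
    define D where "D \<omega> = p n \<omega> * V (Suc n) \<omega> + \<kappa> * ((V (Suc n) \<omega>)\<^sup>2 - \<sigma>\<^sup>2)" for \<omega>
    have T_Suc: "T (Suc n) \<omega> = T n \<omega> + D \<omega>" for \<omega> by (simp add: T_def D_def)
    from Suc have T_past: "T n \<in> borel_measurable (past n)"
      and T2: "integrable M (\<lambda>\<omega>. (T n \<omega>)\<^sup>2)"
      and bT2: "expectation (\<lambda>\<omega>. (T n \<omega>)\<^sup>2) \<le> real n * B" by blast+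
    have [measurable]: "T n \<in> borel_measurable M"
      using T_past by (rule measurable_from_past)
    have [measurable]: "D \<in> borel_measurable M" unfolding D_def[abs_def] by measurable
    have iT: "integrable M (T n)"
      by (rule square_integrable_imp_integrable[OF _ T2]) simp
    have m: "T (Suc n) \<in> borel_measurable (past (Suc n))"
    proof -
      have [measurable]: "T n \<in> borel_measurable (past (Suc n))" "p n \<in> borel_measurable (past (Suc n))"
        using T_past p_past measurable_past_Suc by blast+
      note [measurable] = V_past[OF lessI]
      show ?thesis unfolding T_Suc[abs_def] D_def by measurable
    qed
    have p2_past: "(\<lambda>\<omega>. (p n \<omega>)\<^sup>2) \<in> borel_measurable (past n)"
      using p_past by measurable
    have ipV: "integrable M (\<lambda>\<omega>. (p n \<omega>)\<^sup>2 * (V (Suc n) \<omega>)\<^sup>2)"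
      and epV: "expectation (\<lambda>\<omega>. (p n \<omega>)\<^sup>2 * (V (Suc n) \<omega>)\<^sup>2) = expectation (\<lambda>\<omega>. (p n \<omega>)\<^sup>2) * \<sigma>\<^sup>2"
      using integrable_past_mult[OF p2_past p2, of "\<lambda>v. v\<^sup>2"]
        expectation_past_mult[OF p2_past p2, of "\<lambda>v. v\<^sup>2"] integrable_V2 by (simp_all add: square_V)
    have D2: "(D \<omega>)\<^sup>2 \<le> 2 * ((p n \<omega>)\<^sup>2 * (V (Suc n) \<omega>)\<^sup>2) + 2 * \<kappa>\<^sup>2 * (V (Suc n) \<omega> ^ 4 + \<sigma> ^ 4)" for \<omega>
    proof -
      have "(D \<omega>)\<^sup>2 \<le> 2 * (p n \<omega> * V (Suc n) \<omega>)\<^sup>2 + 2 * (\<kappa> * ((V (Suc n) \<omega>)\<^sup>2 - \<sigma>\<^sup>2))\<^sup>2"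
        unfolding D_def using sum_squares_bound[of "p n \<omega> * V (Suc n) \<omega>" "\<kappa> * ((V (Suc n) \<omega>)\<^sup>2 - \<sigma>\<^sup>2)"]
        by (simp only: power2_sum)
      moreover have "((V (Suc n) \<omega>)\<^sup>2 - \<sigma>\<^sup>2)\<^sup>2 \<le> V (Suc n) \<omega> ^ 4 + \<sigma> ^ 4"
        by (simp add: power2_diff flip: power_mult)
      then have "\<kappa>\<^sup>2 * ((V (Suc n) \<omega>)\<^sup>2 - \<sigma>\<^sup>2)\<^sup>2 \<le> \<kappa>\<^sup>2 * (V (Suc n) \<omega> ^ 4 + \<sigma> ^ 4)"
        by (rule mult_left_mono) simp
      ultimately show ?thesis by (simp only: power_mult_distrib)
    qed
    have ib: "integrable M (\<lambda>\<omega>. 2 * ((p n \<omega>)\<^sup>2 * (V (Suc n) \<omega>)\<^sup>2) + 2 * \<kappa>\<^sup>2 * (V (Suc n) \<omega> ^ 4 + \<sigma> ^ 4))"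
      by (intro Bochner_Integration.integrable_add integrable_mult_right ipV integrable_V4) simp
    have iD2: "integrable M (\<lambda>\<omega>. (D \<omega>)\<^sup>2)"
      by (rule Bochner_Integration.integrable_bound[OF ib])
         (simp, simp only: real_norm_def abs_power2 order_trans[OF D2 abs_ge_self] AE_I2)
    have iTD: "integrable M (\<lambda>\<omega>. T n \<omega> * D \<omega>)"
      by (rule integrable_mult_of_squares[OF _ _ T2 iD2]) simp_all
    have Tp: "(\<lambda>\<omega>. T n \<omega> * p n \<omega>) \<in> borel_measurable (past n)" "integrable M (\<lambda>\<omega>. T n \<omega> * p n \<omega>)"
      using T_past p_past by (auto intro!: integrable_mult_of_squares T2 p2)
    have a: "integrable M (\<lambda>\<omega>. T n \<omega> * p n \<omega> * V (Suc n) \<omega>)"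
      "expectation (\<lambda>\<omega>. T n \<omega> * p n \<omega> * V (Suc n) \<omega>) = 0"
      using integrable_past_mult[OF Tp, of "\<lambda>v. v"] expectation_past_mult[OF Tp, of "\<lambda>v. v"]
        integrable_V by (simp_all add: mean_V)
    have b: "integrable M (\<lambda>\<omega>. T n \<omega> * ((V (Suc n) \<omega>)\<^sup>2 - \<sigma>\<^sup>2))"
      "expectation (\<lambda>\<omega>. T n \<omega> * ((V (Suc n) \<omega>)\<^sup>2 - \<sigma>\<^sup>2)) = 0"
      using integrable_past_mult[OF _ iT, of n "\<lambda>v. v\<^sup>2 - \<sigma>\<^sup>2"]
        expectation_past_mult[OF _ iT, of n "\<lambda>v. v\<^sup>2 - \<sigma>\<^sup>2"] cen T_past by simp_all
    have "expectation (\<lambda>\<omega>. T n \<omega> * D \<omega>)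
        = expectation (\<lambda>\<omega>. T n \<omega> * p n \<omega> * V (Suc n) \<omega> + \<kappa> * (T n \<omega> * ((V (Suc n) \<omega>)\<^sup>2 - \<sigma>\<^sup>2)))"
      by (simp add: D_def algebra_simps)
    also have "\<dots> = 0"
      using a b by (subst Bochner_Integration.integral_add) auto
    finally have eTD: "expectation (\<lambda>\<omega>. T n \<omega> * D \<omega>) = 0" .
    have sq: "(T (Suc n) \<omega>)\<^sup>2 = (T n \<omega>)\<^sup>2 + (D \<omega>)\<^sup>2 + 2 * (T n \<omega> * D \<omega>)" for \<omega>
      by (simp add: T_Suc power2_sum)
    have i: "integrable M (\<lambda>\<omega>. (T (Suc n) \<omega>)\<^sup>2)"
      unfolding sq using T2 iD2 iTD by simp
    have "expectation (\<lambda>\<omega>. (D \<omega>)\<^sup>2)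
        \<le> expectation (\<lambda>\<omega>. 2 * ((p n \<omega>)\<^sup>2 * (V (Suc n) \<omega>)\<^sup>2) + 2 * \<kappa>\<^sup>2 * (V (Suc n) \<omega> ^ 4 + \<sigma> ^ 4))"
      by (intro integral_mono iD2 ib D2)
    also have "\<dots> = 2 * (expectation (\<lambda>\<omega>. (p n \<omega>)\<^sup>2) * \<sigma>\<^sup>2)
        + 2 * \<kappa>\<^sup>2 * (expectation (\<lambda>\<omega>. V (Suc n) \<omega> ^ 4) + \<sigma> ^ 4)"
      using ipV integrable_V4 by (simp add: epV prob_space)
    also have "\<dots> \<le> 2 * (C * \<sigma>\<^sup>2) + 2 * \<kappa>\<^sup>2 * (C\<^sub>V + \<sigma> ^ 4)"
      using bp[of n] bound_V4[of n] by (intro add_mono mult_left_mono mult_right_mono) auto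
    finally have "expectation (\<lambda>\<omega>. (D \<omega>)\<^sup>2) \<le> B" by (simp add: B_def)
    moreover have "expectation (\<lambda>\<omega>. (T (Suc n) \<omega>)\<^sup>2)
        = expectation (\<lambda>\<omega>. (T n \<omega>)\<^sup>2) + expectation (\<lambda>\<omega>. (D \<omega>)\<^sup>2)"
      unfolding sq using T2 iD2 iTD eTD by simp
    ultimately have "expectation (\<lambda>\<omega>. (T (Suc n) \<omega>)\<^sup>2) \<le> real (Suc n) * B"
      using bT2 by (simp add: algebra_simps)
    with m i show ?case by blast
  qed
  then show "T n \<in> borel_measurable (past n)" "integrable M (\<lambda>\<omega>. (T n \<omega>)\<^sup>2)"
    "expectation (\<lambda>\<omega>. (T n \<omega>)\<^sup>2) \<le> real n * (2 * C * \<sigma>\<^sup>2 + 2 * \<kappa>\<^sup>2 * (C\<^sub>V + \<sigma> ^ 4))"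
    by (auto simp: B_def)
qed

end

section \<open>A central limit theorem for sums with a corrector\<close>

text \<open>
  The sums \<open>\<Sum>k<n. x\<^sub>k V\<^bsub>k+1\<^esub>\<close> for an adapted process \<open>x\<close> whose squares average to \<open>l\<close>. The
  averaging property is assumed in the form of a corrector \<open>G\<close>: its increments are \<open>l - x\<^sub>k\<^sup>2\<close> up to
  martingale differences.
\<close>

locale corrected_transform = centered_noise +
  fixes x G P :: "nat \<Rightarrow> 'a \<Rightarrow> real" and \<kappa> l C :: real
  assumes x_past: "\<And>k. x k \<in> borel_measurable (past k)"
    and G_past: "\<And>k. G k \<in> borel_measurable (past k)"
    and P_past: "\<And>k. P k \<in> borel_measurable (past k)"
    and integrable_x4: "\<And>k. integrable M (\<lambda>\<omega>. x k \<omega> ^ 4)"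
    and integrable_G2: "\<And>k. integrable M (\<lambda>\<omega>. (G k \<omega>)\<^sup>2)"
    and integrable_P2: "\<And>k. integrable M (\<lambda>\<omega>. (P k \<omega>)\<^sup>2)"
    and bound_x4: "\<And>k. expectation (\<lambda>\<omega>. x k \<omega> ^ 4) \<le> C"
    and bound_G2: "\<And>k. expectation (\<lambda>\<omega>. (G k \<omega>)\<^sup>2) \<le> C"
    and bound_P2: "\<And>k. expectation (\<lambda>\<omega>. (P k \<omega>)\<^sup>2) \<le> C"
    and corrector: "\<And>k \<omega>. G (Suc k) \<omega> = G k \<omega> - ((x k \<omega>)\<^sup>2 - l)
        + P k \<omega> * V (Suc k) \<omega> + \<kappa> * ((V (Suc k) \<omega>)\<^sup>2 - \<sigma>\<^sup>2)"
    and l_nonneg: "0 \<le> l"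
begin

definition transform :: "nat \<Rightarrow> 'a \<Rightarrow> real" where
  "transform n \<omega> = (\<Sum>k<n. x k \<omega> * V (Suc k) \<omega>)"

lemma transform_Suc: "transform (Suc n) \<omega> = transform n \<omega> + x n \<omega> * V (Suc n) \<omega>"
  by (simp add: transform_def)

lemma measurable_x [measurable]: "x k \<in> borel_measurable M"
  and measurable_G [measurable]: "G k \<in> borel_measurable M"
  and measurable_P [measurable]: "P k \<in> borel_measurable M"
  using x_past G_past P_past by (auto intro: measurable_from_past)

lemma transform_past: "transform n \<in> borel_measurable (past n)"
proof (induction n)
  case (Suc n)
  note [measurable] = Suc[THEN measurable_past_Suc] x_past[THEN measurable_past_Suc] V_past[OF lessI]
  show ?case unfolding transform_Suc[abs_def] by measurable
qed (simp add: transform_def[abs_def])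

lemma measurable_transform [measurable]: "transform n \<in> borel_measurable M"
  using transform_past by (rule measurable_from_past)

lemma integrable_x2: "integrable M (\<lambda>\<omega>. (x k \<omega>)\<^sup>2)"
  by (rule Bochner_Integration.integrable_bound[of _ "\<lambda>\<omega>. 1 + x k \<omega> ^ 4"])
     (use integrable_x4 square_le_one_plus_fourth in auto)

lemma integrable_x: "integrable M (x k)"
  by (rule square_integrable_imp_integrable[OF _ integrable_x2]) simp

lemma integrable_G: "integrable M (G k)"
  by (rule square_integrable_imp_integrable[OF _ integrable_G2]) simp

lemma integrable_P: "integrable M (P k)"
  by (rule square_integrable_imp_integrable[OF _ integrable_P2]) simp

lemma C_nonneg: "0 \<le> C"
  using bound_G2[of 0] by (rule order_trans[rotated]) simp

lemma C\<^sub>V_nonneg: "0 \<le> C\<^sub>V"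
  using bound_V4[of 0] by (rule order_trans[rotated]) simp

lemma integrable_increment2: "integrable M (\<lambda>\<omega>. (x k \<omega> * V (Suc k) \<omega>)\<^sup>2)"
  and bound_increment2: "expectation (\<lambda>\<omega>. (x k \<omega> * V (Suc k) \<omega>)\<^sup>2) \<le> (1 + C) * \<sigma>\<^sup>2"
proof -
  note [measurable] = x_past
  have f: "(\<lambda>\<omega>. (x k \<omega>)\<^sup>2) \<in> borel_measurable (past k)" by measurable
  show "integrable M (\<lambda>\<omega>. (x k \<omega> * V (Suc k) \<omega>)\<^sup>2)"
    using integrable_past_mult[OF f integrable_x2 _ integrable_V2] by (simp add: power_mult_distrib)
  have "expectation (\<lambda>\<omega>. (x k \<omega> * V (Suc k) \<omega>)\<^sup>2) = expectation (\<lambda>\<omega>. (x k \<omega>)\<^sup>2) * \<sigma>\<^sup>2"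
    using expectation_past_mult[OF f integrable_x2 _ integrable_V2]
    by (simp add: power_mult_distrib square_V)
  also have "expectation (\<lambda>\<omega>. (x k \<omega>)\<^sup>2) \<le> expectation (\<lambda>\<omega>. 1 + x k \<omega> ^ 4)"
    by (intro integral_mono integrable_x2 Bochner_Integration.integrable_add integrable_x4)
       (auto intro: square_le_one_plus_fourth)
  also have "\<dots> \<le> 1 + C"
    using bound_x4[of k] integrable_x4[of k] by (simp add: prob_space)
  finally show "expectation (\<lambda>\<omega>. (x k \<omega> * V (Suc k) \<omega>)\<^sup>2) \<le> (1 + C) * \<sigma>\<^sup>2"
    by (simp add: mult_right_mono)
qed

lemma integrable_increment3: "integrable M (\<lambda>\<omega>. \<bar>x k \<omega> * V (Suc k) \<omega>\<bar> ^ 3)"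
  and bound_increment3: "expectation (\<lambda>\<omega>. \<bar>x k \<omega> * V (Suc k) \<omega>\<bar> ^ 3) \<le> (1 + C) * (1 + C\<^sub>V)"
proof -
  note [measurable] = x_past
  have f: "(\<lambda>\<omega>. \<bar>x k \<omega>\<bar> ^ 3) \<in> borel_measurable (past k)" by measurable
  have ix: "integrable M (\<lambda>\<omega>. \<bar>x k \<omega>\<bar> ^ 3)"
    by (rule Bochner_Integration.integrable_bound[of _ "\<lambda>\<omega>. 1 + x k \<omega> ^ 4"])
       (use integrable_x4 abs_cube_le_one_plus_fourth in auto)
  have iv: "integrable M (\<lambda>\<omega>. \<bar>V (Suc k) \<omega>\<bar> ^ 3)"
    by (rule Bochner_Integration.integrable_bound[of _ "\<lambda>\<omega>. 1 + V (Suc k) \<omega> ^ 4"])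
       (use integrable_V4 abs_cube_le_one_plus_fourth in auto)
  show "integrable M (\<lambda>\<omega>. \<bar>x k \<omega> * V (Suc k) \<omega>\<bar> ^ 3)"
    using integrable_past_mult[OF f ix _ iv] by (simp add: power_mult_distrib abs_mult)
  have "expectation (\<lambda>\<omega>. \<bar>x k \<omega> * V (Suc k) \<omega>\<bar> ^ 3)
      = expectation (\<lambda>\<omega>. \<bar>x k \<omega>\<bar> ^ 3) * expectation (\<lambda>\<omega>. \<bar>V (Suc k) \<omega>\<bar> ^ 3)"
    using expectation_past_mult[OF f ix _ iv] by (simp add: power_mult_distrib abs_mult)
  also have "\<dots> \<le> expectation (\<lambda>\<omega>. 1 + x k \<omega> ^ 4) * expectation (\<lambda>\<omega>. 1 + V (Suc k) \<omega> ^ 4)"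
    by (intro mult_mono integral_mono ix iv Bochner_Integration.integrable_add integrable_x4 integrable_V4
          integral_nonneg)
       (auto intro: abs_cube_le_one_plus_fourth)
  also have "\<dots> \<le> (1 + C) * (1 + C\<^sub>V)"
    using bound_x4[of k] bound_V4[of k] integrable_x4[of k] integrable_V4[of k] C_nonneg C\<^sub>V_nonneg
    by (intro mult_mono) (auto simp: prob_space)
  finally show "expectation (\<lambda>\<omega>. \<bar>x k \<omega> * V (Suc k) \<omega>\<bar> ^ 3) \<le> (1 + C) * (1 + C\<^sub>V)" .
qed

definition phase :: "real \<Rightarrow> nat \<Rightarrow> 'a \<Rightarrow> complex" where
  "phase s k \<omega> = iexp (s * transform k \<omega>)"

lemma phase_past: "phase s k \<in> borel_measurable (past k)"
proof -
  note [measurable] = transform_past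
  show ?thesis unfolding phase_def[abs_def] by measurable
qed

lemma measurable_phase [measurable]: "phase s k \<in> borel_measurable M"
  using phase_past by (rule measurable_from_past)

lemma norm_phase [simp]: "norm (phase s k \<omega>) = 1"
  by (simp add: phase_def)

lemma phase_Suc: "phase s (Suc k) \<omega> = phase s k \<omega> * iexp (s * (x k \<omega> * V (Suc k) \<omega>))"
  by (simp add: phase_def transform_Suc ring_distribs exp_add)

lemma integrable_phase_mult:
  assumes "integrable M g"
  shows "integrable M (\<lambda>\<omega>. phase s k \<omega> * of_real (g \<omega>))"
proof (rule Bochner_Integration.integrable_bound[OF assms])
  have [measurable]: "g \<in> borel_measurable M" using assms by simp
  show "(\<lambda>\<omega>. phase s k \<omega> * of_real (g \<omega>)) \<in> borel_measurable M" by measurable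
qed (simp add: norm_mult)

lemma integrable_phase: "integrable M (phase s k)"
  using integrable_phase_mult[of "\<lambda>_. 1" s k] by simp

lemma phase_mult_past:
  assumes g: "g \<in> borel_measurable (past k)" "integrable M g"
    and [measurable]: "v \<in> borel_measurable borel" and v: "integrable M (\<lambda>\<omega>. v (V (Suc k) \<omega>))"
  shows "integrable M (\<lambda>\<omega>. phase s k \<omega> * of_real (g \<omega> * v (V (Suc k) \<omega>)))"
    and "expectation (\<lambda>\<omega>. phase s k \<omega> * of_real (g \<omega> * v (V (Suc k) \<omega>)))
      = expectation (\<lambda>\<omega>. phase s k \<omega> * of_real (g \<omega>)) * of_real (expectation (\<lambda>\<omega>. v (V (Suc k) \<omega>)))"
proof -
  note [measurable] = phase_past g(1)
  have f: "(\<lambda>\<omega>. phase s k \<omega> * of_real (g \<omega>)) \<in> borel_measurable (past k)" by measurable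
  show "integrable M (\<lambda>\<omega>. phase s k \<omega> * of_real (g \<omega> * v (V (Suc k) \<omega>)))"
    using integrable_past_mult[OF f integrable_phase_mult[OF g(2)] _ v] by (simp add: mult.assoc)
  show "expectation (\<lambda>\<omega>. phase s k \<omega> * of_real (g \<omega> * v (V (Suc k) \<omega>)))
      = expectation (\<lambda>\<omega>. phase s k \<omega> * of_real (g \<omega>)) * of_real (expectation (\<lambda>\<omega>. v (V (Suc k) \<omega>)))"
    using expectation_past_mult[OF f integrable_phase_mult[OF g(2)] _ v] by (simp add: mult.assoc)
qed

text \<open>
  Taylor expansion to second order of the new factor of the phase. The linear term has
  mean zero given the past and the quadratic one has mean \<open>\<sigma>\<^sup>2 x\<^sub>k\<^sup>2\<close>; the remainder is bounded by
  third absolute moments.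
\<close>

lemma phase_step:
  "norm (expectation (phase s (Suc k)) - (expectation (phase s k)
      - of_real (s\<^sup>2 * \<sigma>\<^sup>2 / 2) * expectation (\<lambda>\<omega>. phase s k \<omega> * of_real ((x k \<omega>)\<^sup>2))))
    \<le> \<bar>s\<bar> ^ 3 * ((1 + C) * (1 + C\<^sub>V)) / 6"
proof -
  define y where "y \<omega> = x k \<omega> * V (Suc k) \<omega>" for \<omega>
  have [measurable]: "y \<in> borel_measurable M" unfolding y_def[abs_def] by measurable
  define T where "T \<omega> = phase s k \<omega> + \<i> * of_real s * (phase s k \<omega> * of_real (y \<omega>))
      - of_real (s\<^sup>2 / 2) * (phase s k \<omega> * of_real ((y \<omega>)\<^sup>2))" for \<omega>
  note [measurable] = x_past
  have x2: "(\<lambda>\<omega>. (x k \<omega>)\<^sup>2) \<in> borel_measurable (past k)" by measurable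
  have i1: "integrable M (\<lambda>\<omega>. phase s k \<omega> * of_real (y \<omega>))"
    and e1: "expectation (\<lambda>\<omega>. phase s k \<omega> * of_real (y \<omega>)) = 0"
    using phase_mult_past[OF x_past integrable_x, of "\<lambda>v. v"] integrable_V mean_V
    by (auto simp: y_def)
  have i2: "integrable M (\<lambda>\<omega>. phase s k \<omega> * of_real ((y \<omega>)\<^sup>2))"
    and e2: "expectation (\<lambda>\<omega>. phase s k \<omega> * of_real ((y \<omega>)\<^sup>2))
      = expectation (\<lambda>\<omega>. phase s k \<omega> * of_real ((x k \<omega>)\<^sup>2)) * of_real (\<sigma>\<^sup>2)"
    using phase_mult_past[OF x2 integrable_x2, of "\<lambda>v. v\<^sup>2"] integrable_V2 square_V
    by (auto simp: y_def power_mult_distrib)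
  have iT: "integrable M T"
    unfolding T_def[abs_def]
    by (intro Bochner_Integration.integrable_add Bochner_Integration.integrable_diff
        integrable_phase integrable_mult_right i1 i2)
  have eT: "expectation T = expectation (phase s k)
      - of_real (s\<^sup>2 * \<sigma>\<^sup>2 / 2) * expectation (\<lambda>\<omega>. phase s k \<omega> * of_real ((x k \<omega>)\<^sup>2))"
    unfolding T_def[abs_def]
    by (subst Bochner_Integration.integral_diff Bochner_Integration.integral_add integral_mult_right;
        (intro Bochner_Integration.integrable_add
        integrable_phase integrable_mult_right i1 i2)?)+ (simp add: e1 e2[simplified])
  have "norm (phase s (Suc k) \<omega> - T \<omega>) \<le> \<bar>s\<bar> ^ 3 / 6 * \<bar>y \<omega>\<bar> ^ 3" for \<omega>
  proof -
    have "phase s (Suc k) \<omega> - T \<omega>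
        = phase s k \<omega> * (iexp (s * y \<omega>) - (\<Sum>j\<le>2. (\<i> * (s * y \<omega>)) ^ j / fact j))"
      by (simp add: phase_Suc T_def y_def numeral_2_eq_2 algebra_simps)
    then have "norm (phase s (Suc k) \<omega> - T \<omega>)
        = norm (iexp (s * y \<omega>) - (\<Sum>j\<le>2. (\<i> * (s * y \<omega>)) ^ j / fact j))"
      by (simp add: norm_mult)
    also have "\<dots> \<le> \<bar>s * y \<omega>\<bar> ^ Suc 2 / fact (Suc 2)" by (rule iexp_approx1)
    also have "\<dots> = \<bar>s\<bar> ^ 3 / 6 * \<bar>y \<omega>\<bar> ^ 3"
      by (simp add: abs_mult power_mult_distrib fact_numeral)
    finally show ?thesis .
  qed
  then have "norm (expectation (\<lambda>\<omega>. phase s (Suc k) \<omega> - T \<omega>))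
      \<le> expectation (\<lambda>\<omega>. \<bar>s\<bar> ^ 3 / 6 * \<bar>y \<omega>\<bar> ^ 3)"
    using integrable_increment3[of k]
    by (intro norm_integral_le integrable_mult_right
        Bochner_Integration.integrable_diff integrable_phase iT) (auto simp: y_def)
  also have "\<dots> \<le> \<bar>s\<bar> ^ 3 / 6 * ((1 + C) * (1 + C\<^sub>V))"
    using bound_increment3[of k] by (simp add: y_def mult_left_mono)
  also have "expectation (\<lambda>\<omega>. phase s (Suc k) \<omega> - T \<omega>) = expectation (phase s (Suc k)) - expectation T"
    by (intro Bochner_Integration.integral_diff integrable_phase iT)
  finally show ?thesis by (simp add: eT)
qed

text \<open>
  The corrector turns the average of \<open>w\<^sub>k (x\<^sub>k\<^sup>2 - l)\<close> into a telescoping difference of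
  \<open>E (w\<^sub>k G\<^sub>k)\<close>. The price is the replacement of \<open>w\<^sub>k\<close> by \<open>w\<^bsub>k+1\<^esub>\<close> next to \<open>G\<^bsub>k+1\<^esub>\<close>; it is of order \<open>s\<close>,
  since the two phases differ by at most \<open>\<bar>s x\<^sub>k V\<^bsub>k+1\<^esub>\<bar>\<close>.
\<close>

lemma phase_poisson:
  "norm (expectation (\<lambda>\<omega>. phase s k \<omega> * of_real ((x k \<omega>)\<^sup>2 - l))
      - (expectation (\<lambda>\<omega>. phase s k \<omega> * of_real (G k \<omega>))
        - expectation (\<lambda>\<omega>. phase s (Suc k) \<omega> * of_real (G (Suc k) \<omega>))))
    \<le> \<bar>s\<bar> * ((1 + C) * \<sigma>\<^sup>2 + C)"
proof -
  define y where "y \<omega> = x k \<omega> * V (Suc k) \<omega>" for \<omega>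
  have [measurable]: "y \<in> borel_measurable M" unfolding y_def[abs_def] by measurable
  have iy: "integrable M (\<lambda>\<omega>. (y \<omega>)\<^sup>2)" unfolding y_def by (rule integrable_increment2)
  have i1: "integrable M (\<lambda>\<omega>. phase s k \<omega> * of_real (P k \<omega> * V (Suc k) \<omega>))"
    and e1: "expectation (\<lambda>\<omega>. phase s k \<omega> * of_real (P k \<omega> * V (Suc k) \<omega>)) = 0"
    using phase_mult_past[OF P_past integrable_P, of "\<lambda>v. v"] integrable_V mean_V by auto
  have iv: "integrable M (\<lambda>\<omega>. (V (Suc k) \<omega>)\<^sup>2 - \<sigma>\<^sup>2)"
    using integrable_V2 by simp
  have ev: "expectation (\<lambda>\<omega>. (V (Suc k) \<omega>)\<^sup>2 - \<sigma>\<^sup>2) = 0"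
    using integrable_V2 by (simp add: square_V prob_space)
  have i2: "integrable M (\<lambda>\<omega>. phase s k \<omega> * of_real (\<kappa> * ((V (Suc k) \<omega>)\<^sup>2 - \<sigma>\<^sup>2)))"
    and e2: "expectation (\<lambda>\<omega>. phase s k \<omega> * of_real (\<kappa> * ((V (Suc k) \<omega>)\<^sup>2 - \<sigma>\<^sup>2))) = 0"
    using phase_mult_past[of "\<lambda>_. \<kappa>" k "\<lambda>v. v\<^sup>2 - \<sigma>\<^sup>2" s, OF _ _ _ iv, unfolded ev]
    by (simp_all only: of_real_0 mult_zero_right measurable_const integrable_const borel_measurable_diff
        borel_measurable_power measurable_ident_sets space_borel UNIV_I simp_thms)
  have i3: "integrable M (\<lambda>\<omega>. phase s k \<omega> * of_real (G j \<omega>))" for k j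
    by (rule integrable_phase_mult[OF integrable_G])
  have i4: "integrable M (\<lambda>\<omega>. phase s k \<omega> * of_real ((x k \<omega>)\<^sup>2 - l))"
    by (rule integrable_phase_mult) (use integrable_x2 in simp)
  \<comment> \<open>The corrector equation, solved for \<open>x\<^sub>k\<^sup>2 - l\<close> and multiplied by the phase.\<close>
  have "(\<lambda>\<omega>. phase s k \<omega> * of_real ((x k \<omega>)\<^sup>2 - l)) =
      (\<lambda>\<omega>. phase s k \<omega> * of_real (G k \<omega>) - phase s k \<omega> * of_real (G (Suc k) \<omega>)
        + phase s k \<omega> * of_real (P k \<omega> * V (Suc k) \<omega>)
        + phase s k \<omega> * of_real (\<kappa> * ((V (Suc k) \<omega>)\<^sup>2 - \<sigma>\<^sup>2)))"
    by (rule ext, subst corrector) (simp add: algebra_simps)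
  then have "expectation (\<lambda>\<omega>. phase s k \<omega> * of_real ((x k \<omega>)\<^sup>2 - l)) =
      expectation (\<lambda>\<omega>. phase s k \<omega> * of_real (G k \<omega>))
      - expectation (\<lambda>\<omega>. phase s k \<omega> * of_real (G (Suc k) \<omega>))"
    by (simp only: Bochner_Integration.integral_diff Bochner_Integration.integral_add
        Bochner_Integration.integrable_add Bochner_Integration.integrable_diff i1 i2 i3 e1 e2) simp
  then have "expectation (\<lambda>\<omega>. phase s k \<omega> * of_real ((x k \<omega>)\<^sup>2 - l))
      - (expectation (\<lambda>\<omega>. phase s k \<omega> * of_real (G k \<omega>))
        - expectation (\<lambda>\<omega>. phase s (Suc k) \<omega> * of_real (G (Suc k) \<omega>)))
    = expectation (\<lambda>\<omega>. phase s (Suc k) \<omega> * of_real (G (Suc k) \<omega>) - phase s k \<omega> * of_real (G (Suc k) \<omega>))"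
    by (simp add: Bochner_Integration.integral_diff i3)
  also have "norm \<dots> \<le> expectation (\<lambda>\<omega>. \<bar>s\<bar> * ((y \<omega>)\<^sup>2 + (G (Suc k) \<omega>)\<^sup>2))"
  proof (intro norm_integral_le integrable_mult_right
        Bochner_Integration.integrable_diff Bochner_Integration.integrable_add i3 iy integrable_G2)
    fix \<omega>
    have "phase s (Suc k) \<omega> * of_real (G (Suc k) \<omega>) - phase s k \<omega> * of_real (G (Suc k) \<omega>)
        = phase s k \<omega> * ((iexp (s * y \<omega>) - (\<Sum>j\<le>0. (\<i> * (s * y \<omega>)) ^ j / fact j)) * of_real (G (Suc k) \<omega>))"
      by (simp add: phase_Suc y_def algebra_simps)
    then have "norm (phase s (Suc k) \<omega> * of_real (G (Suc k) \<omega>) - phase s k \<omega> * of_real (G (Suc k) \<omega>))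
        = norm (iexp (s * y \<omega>) - (\<Sum>j\<le>0. (\<i> * (s * y \<omega>)) ^ j / fact j)) * \<bar>G (Suc k) \<omega>\<bar>"
      by (simp add: norm_mult)
    also have "\<dots> \<le> \<bar>s * y \<omega>\<bar> ^ Suc 0 / fact (Suc 0) * \<bar>G (Suc k) \<omega>\<bar>"
      by (intro mult_right_mono iexp_approx1) simp
    also have "\<dots> = \<bar>s\<bar> * (\<bar>y \<omega>\<bar> * \<bar>G (Suc k) \<omega>\<bar>)" by (simp add: abs_mult)
    also have "\<bar>y \<omega>\<bar> * \<bar>G (Suc k) \<omega>\<bar> \<le> (y \<omega>)\<^sup>2 + (G (Suc k) \<omega>)\<^sup>2"
      using sum_squares_bound[of "\<bar>y \<omega>\<bar>" "\<bar>G (Suc k) \<omega>\<bar>"]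
        mult_nonneg_nonneg[of "\<bar>y \<omega>\<bar>" "\<bar>G (Suc k) \<omega>\<bar>"] by (simp only: power2_abs) linarith
    finally show "norm (phase s (Suc k) \<omega> * of_real (G (Suc k) \<omega>) - phase s k \<omega> * of_real (G (Suc k) \<omega>))
        \<le> \<bar>s\<bar> * ((y \<omega>)\<^sup>2 + (G (Suc k) \<omega>)\<^sup>2)" by (simp add: mult_left_mono)
  qed
  also have "\<dots> = \<bar>s\<bar> * (expectation (\<lambda>\<omega>. (y \<omega>)\<^sup>2) + expectation (\<lambda>\<omega>. (G (Suc k) \<omega>)\<^sup>2))"
    using iy integrable_G2 by simp
  also have "\<dots> \<le> \<bar>s\<bar> * ((1 + C) * \<sigma>\<^sup>2 + C)"
    using bound_increment2[of k] bound_G2[of "Suc k"] by (intro mult_left_mono add_mono) (auto simp: y_def)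
  finally show ?thesis .
qed

lemma norm_phase_G: "norm (expectation (\<lambda>\<omega>. phase s k \<omega> * of_real (G k \<omega>))) \<le> 1 + C"
proof -
  have "norm (expectation (\<lambda>\<omega>. phase s k \<omega> * of_real (G k \<omega>))) \<le> expectation (\<lambda>\<omega>. 1 + (G k \<omega>)\<^sup>2)"
    using integrable_G2
    by (intro norm_integral_le integrable_phase_mult integrable_G)
       (auto simp: norm_mult abs_le_one_plus_square)
  also have "\<dots> \<le> 1 + C" using bound_G2[of k] integrable_G2[of k] by (simp add: prob_space)
  finally show ?thesis .
qed

text \<open>
  The corrected quantity \<open>z\<^sub>k = E w\<^sub>k - h E (w\<^sub>k G\<^sub>k)\<close> satisfies the recursion with constant factor
  \<open>1 - h l\<close> up to an error of third order in \<open>s\<close>, while it differs from \<open>E w\<^sub>k\<close> by \<open>O(h)\<close> only.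
\<close>

lemma char_transform_bound:
  fixes s :: real
  defines "h \<equiv> s\<^sup>2 * \<sigma>\<^sup>2 / 2"
  assumes hl: "h * l \<le> 1"
  shows "norm (expectation (phase s n) - of_real ((1 - h * l) ^ n))
    \<le> real n * (\<bar>s\<bar> ^ 3 * ((1 + C) * (1 + C\<^sub>V)) / 6 + h * (\<bar>s\<bar> * ((1 + C) * \<sigma>\<^sup>2 + C)) + h\<^sup>2 * l * (1 + C))
      + 2 * h * (1 + C)"
proof -
  define a where "a k = expectation (\<lambda>\<omega>. phase s k \<omega> * of_real (G k \<omega>))" for k
  define z where "z k = expectation (phase s k) - of_real h * a k" for k
  define q where "q = 1 - h * l"
  define d where "d = \<bar>s\<bar> ^ 3 * ((1 + C) * (1 + C\<^sub>V)) / 6 + h * (\<bar>s\<bar> * ((1 + C) * \<sigma>\<^sup>2 + C)) + h\<^sup>2 * l * (1 + C)"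
  have h: "0 \<le> h" by (simp add: h_def)
  have q: "0 \<le> q" "q \<le> 1" using hl h l_nonneg by (auto simp: q_def)
  have step: "norm (z (Suc k) - of_real q * z k) \<le> d" for k
  proof -
    define R where "R = expectation (phase s (Suc k)) - (expectation (phase s k)
      - of_real h * expectation (\<lambda>\<omega>. phase s k \<omega> * of_real ((x k \<omega>)\<^sup>2)))"
    define Q where "Q = expectation (\<lambda>\<omega>. phase s k \<omega> * of_real ((x k \<omega>)\<^sup>2 - l)) - (a k - a (Suc k))"
    have "expectation (\<lambda>\<omega>. phase s k \<omega> * of_real ((x k \<omega>)\<^sup>2 - l))
        = expectation (\<lambda>\<omega>. phase s k \<omega> * of_real ((x k \<omega>)\<^sup>2) - phase s k \<omega> * of_real l)"
      by (simp add: algebra_simps)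
    also have "\<dots> = expectation (\<lambda>\<omega>. phase s k \<omega> * of_real ((x k \<omega>)\<^sup>2)) - expectation (phase s k) * of_real l"
      by (subst Bochner_Integration.integral_diff)
         (auto intro!: integrable_phase_mult[OF integrable_x2, simplified] integrable_phase)
    finally have split: "expectation (\<lambda>\<omega>. phase s k \<omega> * of_real ((x k \<omega>)\<^sup>2 - l))
        = expectation (\<lambda>\<omega>. phase s k \<omega> * of_real ((x k \<omega>)\<^sup>2)) - expectation (phase s k) * of_real l" .
    have "z (Suc k) - of_real q * z k = R - of_real h * Q - of_real (h\<^sup>2 * l) * a k"
      unfolding z_def R_def Q_def q_def split by (simp add: algebra_simps power2_eq_square)
    also have "norm \<dots> \<le> norm R + norm (of_real h * Q) + norm (of_real (h\<^sup>2 * l) * a k)"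
      by (intro order_trans[OF norm_triangle_ineq4] add_mono order_refl)
    also have "\<dots> = norm R + h * norm Q + h\<^sup>2 * l * norm (a k)"
      using h l_nonneg by (simp add: norm_mult norm_power)
    also have "\<dots> \<le> d"
      unfolding d_def
      using h l_nonneg phase_step[of s k] phase_poisson[of s k] norm_phase_G[of s k]
      by (intro add_mono mult_left_mono) (auto simp: R_def Q_def h_def a_def)
    finally show ?thesis .
  qed
  from affine_recursion_deviation[OF q, of z d n]
  have zn: "norm (z n - of_real (q ^ n) * z 0) \<le> real n * d" using step by blast
  have "expectation (phase s n) - of_real (q ^ n)
      = (z n - of_real (q ^ n) * z 0) + of_real h * a n - of_real (q ^ n) * (of_real h * a 0)"
    by (simp add: z_def phase_def[abs_def] transform_def prob_space algebra_simps)
  also have "norm \<dots> \<le> norm (z n - of_real (q ^ n) * z 0) + norm (of_real h * a n)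
      + norm (of_real (q ^ n) * (of_real h * a 0))"
    by (intro order_trans[OF norm_triangle_ineq4] add_mono norm_triangle_ineq order_refl)
  also have "\<dots> = norm (z n - of_real (q ^ n) * z 0) + h * norm (a n) + q ^ n * (h * norm (a 0))"
    using h q by (simp add: norm_mult norm_power)
  also have "\<dots> \<le> real n * d + h * (1 + C) + 1 * (h * (1 + C))"
    using h q zn norm_phase_G[of s] C_nonneg
    by (intro add_mono mult_mono mult_left_mono power_le_one) (auto simp: a_def)
  finally show ?thesis by (simp add: d_def q_def)
qed

text \<open>
  With \<open>s = t / \<surd>n\<close> the \<open>n\<close> errors of order \<open>\<bar>s\<bar>\<^sup>3\<close> sum to \<open>O(1 / \<surd>n)\<close>, and \<open>(1 - h l)\<^sup>n\<close> is the
  usual approximation of the exponential function.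
\<close>

theorem char_transform_limit:
  "(\<lambda>n. expectation (\<lambda>\<omega>. iexp (t * (transform n \<omega> / sqrt n)))) \<longlonglongrightarrow> exp (- (t\<^sup>2 * (\<sigma>\<^sup>2 * l) / 2))"
proof -
  define s where "s n = t / sqrt (real n)" for n :: nat
  define h where "h n = (s n)\<^sup>2 * \<sigma>\<^sup>2 / 2" for n
  define A where "A = (1 + C) * (1 + C\<^sub>V) / 6 + \<sigma>\<^sup>2 / 2 * ((1 + C) * \<sigma>\<^sup>2 + C)"
  define B where "B = \<sigma>\<^sup>2 / 2 * (\<sigma>\<^sup>2 / 2) * l * (1 + C)"
  have s: "s \<longlonglongrightarrow> 0" unfolding s_def by real_asymp
  have h: "h \<longlonglongrightarrow> 0" unfolding h_def by (rule tendsto_eq_intros s | simp)+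
  have "(\<lambda>n. of_real ((1 - h n * l) ^ n) :: complex) \<longlonglongrightarrow> of_real (exp (- (t\<^sup>2 * (\<sigma>\<^sup>2 * l) / 2)))"
  proof (rule tendsto_of_real)
    have "(\<lambda>n. (1 + (- (t\<^sup>2 * (\<sigma>\<^sup>2 * l) / 2)) / real n) ^ n) \<longlonglongrightarrow> exp (- (t\<^sup>2 * (\<sigma>\<^sup>2 * l) / 2))"
      by (rule tendsto_exp_limit_sequentially)
    also have "(\<lambda>n. (1 + (- (t\<^sup>2 * (\<sigma>\<^sup>2 * l) / 2)) / real n) ^ n) = (\<lambda>n. (1 - h n * l) ^ n)"
      by (simp add: h_def s_def power_divide mult_ac)
    finally show "(\<lambda>n. (1 - h n * l) ^ n) \<longlonglongrightarrow> exp (- (t\<^sup>2 * (\<sigma>\<^sup>2 * l) / 2))" .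
  qed
  moreover have "(\<lambda>n. expectation (phase (s n) n) - of_real ((1 - h n * l) ^ n)) \<longlonglongrightarrow> 0"
  proof (rule Lim_null_comparison)
    have "(\<lambda>n. h n * l) \<longlonglongrightarrow> 0" by (rule tendsto_eq_intros h | simp)+
    then have "\<forall>\<^sub>F n in sequentially. h n * l < 1" by (rule order_tendstoD) simp
    then show "\<forall>\<^sub>F n in sequentially. norm (expectation (phase (s n) n) - of_real ((1 - h n * l) ^ n))
        \<le> \<bar>t\<bar> ^ 3 / sqrt (real n) * (A + \<bar>s n\<bar> * B) + 2 * h n * (1 + C)"
      using eventually_gt_at_top[of 0]
    proof eventually_elim
      case (elim n)
      have "norm (expectation (phase (s n) n) - of_real ((1 - h n * l) ^ n))
        \<le> real n * (\<bar>s n\<bar> ^ 3 * ((1 + C) * (1 + C\<^sub>V)) / 6 + h n * (\<bar>s n\<bar> * ((1 + C) * \<sigma>\<^sup>2 + C))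
            + (h n)\<^sup>2 * l * (1 + C)) + 2 * h n * (1 + C)"
        using char_transform_bound[of "s n" n] elim by (simp add: h_def)
      also have "\<bar>s n\<bar> ^ 3 * ((1 + C) * (1 + C\<^sub>V)) / 6 + h n * (\<bar>s n\<bar> * ((1 + C) * \<sigma>\<^sup>2 + C))
            + (h n)\<^sup>2 * l * (1 + C) = \<bar>s n\<bar> ^ 3 * (A + \<bar>s n\<bar> * B)"
      proof -
        define r where "r = \<bar>s n\<bar>"
        have hr: "h n = r\<^sup>2 * \<sigma>\<^sup>2 / 2" by (simp add: h_def r_def)
        show ?thesis unfolding r_def[symmetric] A_def B_def
            by (simp add: hr field_simps power2_eq_square power3_eq_cube)
      qed
      also have "real n * (\<bar>s n\<bar> ^ 3 * (A + \<bar>s n\<bar> * B)) = \<bar>t\<bar> ^ 3 / sqrt (real n) * (A + \<bar>s n\<bar> * B)"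
      proof -
        have "real n = sqrt (real n) ^ 2" by simp
        then have "real n * \<bar>s n\<bar> ^ 3 = \<bar>t\<bar> ^ 3 / sqrt (real n)"
          using elim by (simp add: s_def power_divide abs_divide field_simps power2_eq_square power3_eq_cube)
        then show ?thesis by (metis mult.assoc)
      qed
      finally show ?case .
    qed
    have t: "(\<lambda>n. \<bar>t\<bar> ^ 3 / sqrt (real n)) \<longlonglongrightarrow> 0" by real_asymp
    have "(\<lambda>n. \<bar>t\<bar> ^ 3 / sqrt (real n) * (A + \<bar>s n\<bar> * B) + 2 * h n * (1 + C))
        \<longlonglongrightarrow> 0 * (A + \<bar>0\<bar> * B) + 2 * 0 * (1 + C)"
      by (intro tendsto_intros s h t)
    then show "(\<lambda>n. \<bar>t\<bar> ^ 3 / sqrt (real n) * (A + \<bar>s n\<bar> * B) + 2 * h n * (1 + C)) \<longlonglongrightarrow> 0"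
      by simp
  qed
  ultimately have "(\<lambda>n. expectation (phase (s n) n)) \<longlonglongrightarrow> of_real (exp (- (t\<^sup>2 * (\<sigma>\<^sup>2 * l) / 2)))"
    by (rule Lim_transform)
  then show ?thesis by (simp add: phase_def[abs_def] s_def)
qed

text \<open>
  Summing the corrector equation: the deviation is a boundary term \<open>G\<^sub>0 - G\<^sub>n\<close> plus a
  martingale, so its second moment grows at most linearly.
\<close>

theorem sum_square_deviation:
  "\<exists>B. \<forall>n. integrable M (\<lambda>\<omega>. (\<Sum>k<n. (x k \<omega>)\<^sup>2 - l)\<^sup>2)
     \<and> expectation (\<lambda>\<omega>. (\<Sum>k<n. (x k \<omega>)\<^sup>2 - l)\<^sup>2) \<le> B * (1 + real n)"
proof -
  define T where "T n \<omega> = (\<Sum>k<n. P k \<omega> * V (Suc k) \<omega> + \<kappa> * ((V (Suc k) \<omega>)\<^sup>2 - \<sigma>\<^sup>2))" for n \<omega>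
  define B where "B = 2 * C * \<sigma>\<^sup>2 + 2 * \<kappa>\<^sup>2 * (C\<^sub>V + \<sigma> ^ 4)"
  have [measurable]: "T n \<in> borel_measurable M"
    and iT: "integrable M (\<lambda>\<omega>. (T n \<omega>)\<^sup>2)"
    and bT: "expectation (\<lambda>\<omega>. (T n \<omega>)\<^sup>2) \<le> real n * B" for n
    using martingale_second_moment[OF P_past integrable_P2 bound_P2, where n=n and \<kappa>=\<kappa>]
    by (auto simp: T_def[abs_def] B_def intro: measurable_from_past)
  have B: "0 \<le> B" using C_nonneg C\<^sub>V_nonneg by (simp add: B_def)
  have eq: "(\<Sum>k<n. (x k \<omega>)\<^sup>2 - l) = G 0 \<omega> - G n \<omega> + T n \<omega>" for n \<omega>
    by (induction n) (simp_all add: T_def corrector)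
  have bound: "(\<Sum>k<n. (x k \<omega>)\<^sup>2 - l)\<^sup>2 \<le> 3 * ((G 0 \<omega>)\<^sup>2 + (G n \<omega>)\<^sup>2 + (T n \<omega>)\<^sup>2)" for n \<omega>
  proof -
    have "3 * (a\<^sup>2 + b\<^sup>2 + c\<^sup>2) - (a - b + c)\<^sup>2 = (a + b)\<^sup>2 + (a - c)\<^sup>2 + (b + c)\<^sup>2" for a b c :: real
      by (simp add: power2_eq_square algebra_simps)
    from this[of "G 0 \<omega>" "G n \<omega>" "T n \<omega>"] show ?thesis
      unfolding eq by (smt (verit) zero_le_power2)
  qed
  have i: "integrable M (\<lambda>\<omega>. 3 * ((G 0 \<omega>)\<^sup>2 + (G n \<omega>)\<^sup>2 + (T n \<omega>)\<^sup>2))" for n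
    using integrable_G2 iT by simp
  have j: "integrable M (\<lambda>\<omega>. (\<Sum>k<n. (x k \<omega>)\<^sup>2 - l)\<^sup>2)" for n
    by (rule Bochner_Integration.integrable_bound[OF i[of n]]) (auto intro!: AE_I2 order_trans[OF bound] simp: algebra_simps)
  have "expectation (\<lambda>\<omega>. (\<Sum>k<n. (x k \<omega>)\<^sup>2 - l)\<^sup>2) \<le> (6 * C + 3 * B) * (1 + real n)" for n
  proof -
    have "expectation (\<lambda>\<omega>. (\<Sum>k<n. (x k \<omega>)\<^sup>2 - l)\<^sup>2)
        \<le> expectation (\<lambda>\<omega>. 3 * ((G 0 \<omega>)\<^sup>2 + (G n \<omega>)\<^sup>2 + (T n \<omega>)\<^sup>2))"
      using bound by (intro integral_mono i j) auto
    also have "\<dots> = 3 * (expectation (\<lambda>\<omega>. (G 0 \<omega>)\<^sup>2) + expectation (\<lambda>\<omega>. (G n \<omega>)\<^sup>2)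
        + expectation (\<lambda>\<omega>. (T n \<omega>)\<^sup>2))"
      using integrable_G2 iT by simp
    also have "\<dots> \<le> 3 * (C + C + real n * B)"
      by (intro mult_left_mono add_mono bound_G2 bT) simp
    also have "\<dots> \<le> (6 * C + 3 * B) * (1 + real n)"
      using B C_nonneg by (simp add: algebra_simps)
    finally show ?thesis .
  qed
  with j show ?thesis by blast
qed

theorem transform_second_moment:
  "integrable M (\<lambda>\<omega>. (transform n \<omega>)\<^sup>2)"
  "expectation (\<lambda>\<omega>. (transform n \<omega>)\<^sup>2) \<le> real n * (2 * (1 + C) * \<sigma>\<^sup>2)"
proof -
  have "expectation (\<lambda>\<omega>. (x k \<omega>)\<^sup>2) \<le> 1 + C" for k
  proof -
    have "expectation (\<lambda>\<omega>. (x k \<omega>)\<^sup>2) \<le> expectation (\<lambda>\<omega>. 1 + x k \<omega> ^ 4)"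
      by (intro integral_mono integrable_x2 Bochner_Integration.integrable_add integrable_x4)
         (auto intro: square_le_one_plus_fourth)
    then show ?thesis
      using bound_x4[of k] integrable_x4[of k] by (simp add: prob_space)
  qed
  \<comment> \<open>The case \<open>\<kappa> = 0\<close> of the general bound, without centered squares.\<close>
  from martingale_second_moment[OF x_past integrable_x2 this, where n=n and \<kappa>=0]
  show "integrable M (\<lambda>\<omega>. (transform n \<omega>)\<^sup>2)"
    "expectation (\<lambda>\<omega>. (transform n \<omega>)\<^sup>2) \<le> real n * (2 * (1 + C) * \<sigma>\<^sup>2)"
    by (simp_all add: transform_def)
qed

end

section \<open>The autoregressive process started at zero\<close>

text \<open>
  Convexity of the fourth power, applied to \<open>r u + v\<close> written as the convex combination of
  \<open>sgn r u\<close> and \<open>v / (1 - \<bar>r\<bar>)\<close> with weights \<open>\<bar>r\<bar>\<close> and \<open>1 - \<bar>r\<bar>\<close>.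
\<close>

lemma convex_fourth_power:
  fixes r u v :: real
  assumes "\<bar>r\<bar> < 1"
  shows "(r * u + v) ^ 4 \<le> \<bar>r\<bar> * u ^ 4 + v ^ 4 / (1 - \<bar>r\<bar>) ^ 3"
proof -
  define p where "p = \<bar>r\<bar>"
  have p: "0 \<le> p" "p < 1" using assms by (auto simp: p_def)
  have sq: "(p * a + (1 - p) * b)\<^sup>2 \<le> p * a\<^sup>2 + (1 - p) * b\<^sup>2" for a b :: real
  proof -
    have "p * a\<^sup>2 + (1 - p) * b\<^sup>2 - (p * a + (1 - p) * b)\<^sup>2 = p * (1 - p) * (a - b)\<^sup>2"
      by (simp add: power2_eq_square algebra_simps)
    also have "\<dots> \<ge> 0" using p by simp
    finally show ?thesis by simp
  qed
  have fourth: "(p * a + (1 - p) * b) ^ 4 \<le> p * a ^ 4 + (1 - p) * b ^ 4" for a b :: real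
  proof -
    have "(p * a + (1 - p) * b) ^ 4 = ((p * a + (1 - p) * b)\<^sup>2)\<^sup>2" by simp
    also have "\<dots> \<le> (p * a\<^sup>2 + (1 - p) * b\<^sup>2)\<^sup>2"
      by (rule power_mono[OF sq]) simp
    also have "\<dots> \<le> p * (a\<^sup>2)\<^sup>2 + (1 - p) * (b\<^sup>2)\<^sup>2" by (rule sq)
    finally show ?thesis by simp
  qed
  have "(p * (sgn r * u) + (1 - p) * (v / (1 - p))) ^ 4
      \<le> p * (sgn r * u) ^ 4 + (1 - p) * (v / (1 - p)) ^ 4" by (rule fourth)
  also have "p * (sgn r * u) + (1 - p) * (v / (1 - p)) = r * u + v"
    using p by (simp add: p_def mult.assoc[symmetric] abs_mult_sgn)
  also have "(1 - p) * (v / (1 - p)) ^ 4 = v ^ 4 / (1 - p) ^ 3"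
    using p by (simp add: power_divide power4_eq_xxxx power3_eq_cube)
  also have "p * (sgn r * u) ^ 4 \<le> p * u ^ 4"
  proof (rule mult_left_mono)
    show "(sgn r * u) ^ 4 \<le> u ^ 4" by (auto simp: sgn_if)
  qed (use p in simp)
  finally show ?thesis by (simp add: p_def)
qed

text \<open>
  A contracting recursion keeps fourth moments bounded: the bound is the fixed point of
  \<open>m \<mapsto> \<bar>r\<bar> m + K / (1 - \<bar>r\<bar>)\<^sup>3\<close>. Dependence between \<open>y\<close> and \<open>v\<close> is allowed, so that the lemma applies to
  \<open>e\<close> driven by the noise and then to \<open>x\<close> driven by \<open>e\<close>.
\<close>

lemma (in prob_space) fourth_moment_recursion:
  fixes y v :: "nat \<Rightarrow> 'a \<Rightarrow> real"
  assumes r: "\<bar>r\<bar> < 1"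
    and y0: "\<And>\<omega>. y 0 \<omega> = 0" and y_Suc: "\<And>n \<omega>. y (Suc n) \<omega> = r * y n \<omega> + v n \<omega>"
    and v: "\<And>n. v n \<in> borel_measurable M" "\<And>n. integrable M (\<lambda>\<omega>. v n \<omega> ^ 4)"
    and b: "\<And>n. expectation (\<lambda>\<omega>. v n \<omega> ^ 4) \<le> K"
  shows "y n \<in> borel_measurable M"
    and "integrable M (\<lambda>\<omega>. y n \<omega> ^ 4)"
    and "expectation (\<lambda>\<omega>. y n \<omega> ^ 4) \<le> K / (1 - \<bar>r\<bar>) ^ 4"
proof -
  have K: "0 \<le> K" using b[of 0] by (rule order_trans[rotated]) simp
  have "y n \<in> borel_measurable M \<and> integrable M (\<lambda>\<omega>. y n \<omega> ^ 4)
      \<and> expectation (\<lambda>\<omega>. y n \<omega> ^ 4) \<le> K / (1 - \<bar>r\<bar>) ^ 4"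
  proof (induction n)
    case 0
    have "y 0 = (\<lambda>_. 0)" using y0 by auto
    then show ?case using r K by simp
  next
    case (Suc n)
    then have [measurable]: "y n \<in> borel_measurable M" and i: "integrable M (\<lambda>\<omega>. y n \<omega> ^ 4)"
      and e: "expectation (\<lambda>\<omega>. y n \<omega> ^ 4) \<le> K / (1 - \<bar>r\<bar>) ^ 4" by auto
    note [measurable] = v(1)
    have m: "y (Suc n) \<in> borel_measurable M" unfolding y_Suc[abs_def] by measurable
    have bound: "y (Suc n) \<omega> ^ 4 \<le> \<bar>r\<bar> * y n \<omega> ^ 4 + v n \<omega> ^ 4 / (1 - \<bar>r\<bar>) ^ 3" for \<omega>
      unfolding y_Suc by (rule convex_fourth_power[OF r])
    have j: "integrable M (\<lambda>\<omega>. \<bar>r\<bar> * y n \<omega> ^ 4 + v n \<omega> ^ 4 / (1 - \<bar>r\<bar>) ^ 3)"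
      using i v(2)[of n] by simp
    have i': "integrable M (\<lambda>\<omega>. y (Suc n) \<omega> ^ 4)"
      by (rule Bochner_Integration.integrable_bound[OF j])
         (use m in simp, simp only: real_norm_def power_even_abs_numeral order_trans[OF bound abs_ge_self]
            AE_I2 abs_of_nonneg zero_le_even_power even_numeral)
    have "expectation (\<lambda>\<omega>. y (Suc n) \<omega> ^ 4)
        \<le> expectation (\<lambda>\<omega>. \<bar>r\<bar> * y n \<omega> ^ 4 + v n \<omega> ^ 4 / (1 - \<bar>r\<bar>) ^ 3)"
      by (intro integral_mono i' j bound)
    also have "\<dots> = \<bar>r\<bar> * expectation (\<lambda>\<omega>. y n \<omega> ^ 4) + expectation (\<lambda>\<omega>. v n \<omega> ^ 4) / (1 - \<bar>r\<bar>) ^ 3"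
      using i v(2)[of n] by simp
    also have "\<dots> \<le> \<bar>r\<bar> * (K / (1 - \<bar>r\<bar>) ^ 4) + K / (1 - \<bar>r\<bar>) ^ 3"
      using r e b[of n] by (intro add_mono mult_left_mono divide_right_mono) auto
    also have "\<dots> = K / (1 - \<bar>r\<bar>) ^ 4"
    proof -
      have "K / (1 - \<bar>r\<bar>) ^ 3 = (1 - \<bar>r\<bar>) * (K / (1 - \<bar>r\<bar>) ^ 4)"
        using r by (simp add: power4_eq_xxxx power3_eq_cube)
      moreover have "a * d + b = d" if "b = (1 - a) * d" for a b d :: real
        using that by (simp add: algebra_simps)
      ultimately show ?thesis by blast
    qed
    finally show ?case using m i' by blast
  qed
  then show "y n \<in> borel_measurable M" "integrable M (\<lambda>\<omega>. y n \<omega> ^ 4)"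
    "expectation (\<lambda>\<omega>. y n \<omega> ^ 4) \<le> K / (1 - \<bar>r\<bar>) ^ 4" by auto
qed

lemma (in prob_space) square_of_quadratic_form:
  fixes u v :: "'a \<Rightarrow> real"
  assumes [measurable]: "u \<in> borel_measurable M" "v \<in> borel_measurable M"
    and i: "integrable M (\<lambda>\<omega>. u \<omega> ^ 4)" "integrable M (\<lambda>\<omega>. v \<omega> ^ 4)"
    and b: "expectation (\<lambda>\<omega>. u \<omega> ^ 4) \<le> K" "expectation (\<lambda>\<omega>. v \<omega> ^ 4) \<le> K"
  shows "integrable M (\<lambda>\<omega>. (a * (u \<omega>)\<^sup>2 + b * (u \<omega> * v \<omega>) + c * (v \<omega>)\<^sup>2)\<^sup>2)"
    and "expectation (\<lambda>\<omega>. (a * (u \<omega>)\<^sup>2 + b * (u \<omega> * v \<omega>) + c * (v \<omega>)\<^sup>2)\<^sup>2)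
      \<le> 6 * (a\<^sup>2 + b\<^sup>2 + c\<^sup>2) * K"
proof -
  have three: "(p + q + r)\<^sup>2 \<le> 3 * (p\<^sup>2 + q\<^sup>2 + r\<^sup>2)" for p q r :: real
  proof -
    have "3 * (p\<^sup>2 + q\<^sup>2 + r\<^sup>2) - (p + q + r)\<^sup>2 = (p - q)\<^sup>2 + (p - r)\<^sup>2 + (q - r)\<^sup>2"
      by (simp add: power2_eq_square algebra_simps)
    then show ?thesis by (smt (verit) zero_le_power2)
  qed
  have bound: "(a * U\<^sup>2 + b * (U * W) + c * W\<^sup>2)\<^sup>2 \<le> 3 * (a\<^sup>2 + b\<^sup>2 + c\<^sup>2) * (U ^ 4 + W ^ 4)" for U W :: real
  proof -
    have "2 * (U\<^sup>2 * W\<^sup>2) \<le> U ^ 4 + W ^ 4"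
      using sum_squares_bound[of "U\<^sup>2" "W\<^sup>2"] by simp
    then have uw: "(U * W)\<^sup>2 \<le> U ^ 4 + W ^ 4"
      by (smt (verit) power_mult_distrib zero_le_power2 mult_nonneg_nonneg)
    have "(a * U\<^sup>2 + b * (U * W) + c * W\<^sup>2)\<^sup>2
        \<le> 3 * (a\<^sup>2 * U ^ 4 + b\<^sup>2 * (U * W)\<^sup>2 + c\<^sup>2 * W ^ 4)"
      using three[of "a * U\<^sup>2" "b * (U * W)" "c * W\<^sup>2"] by (simp add: power_mult_distrib)
    also have "\<dots> \<le> 3 * (a\<^sup>2 * (U ^ 4 + W ^ 4) + b\<^sup>2 * (U ^ 4 + W ^ 4) + c\<^sup>2 * (U ^ 4 + W ^ 4))"
      using uw by (intro mult_left_mono add_mono) auto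
    finally show ?thesis by (simp add: algebra_simps)
  qed
  have j: "integrable M (\<lambda>\<omega>. 3 * (a\<^sup>2 + b\<^sup>2 + c\<^sup>2) * (u \<omega> ^ 4 + v \<omega> ^ 4))"
    using i by simp
  show int: "integrable M (\<lambda>\<omega>. (a * (u \<omega>)\<^sup>2 + b * (u \<omega> * v \<omega>) + c * (v \<omega>)\<^sup>2)\<^sup>2)"
    by (rule Bochner_Integration.integrable_bound[OF j])
       (simp, simp only: real_norm_def abs_power2 order_trans[OF bound abs_ge_self] AE_I2)
  have "expectation (\<lambda>\<omega>. (a * (u \<omega>)\<^sup>2 + b * (u \<omega> * v \<omega>) + c * (v \<omega>)\<^sup>2)\<^sup>2)
      \<le> expectation (\<lambda>\<omega>. 3 * (a\<^sup>2 + b\<^sup>2 + c\<^sup>2) * (u \<omega> ^ 4 + v \<omega> ^ 4))"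
    by (intro integral_mono int j bound)
  also have "\<dots> = 3 * (a\<^sup>2 + b\<^sup>2 + c\<^sup>2) * (expectation (\<lambda>\<omega>. u \<omega> ^ 4) + expectation (\<lambda>\<omega>. v \<omega> ^ 4))"
    using i by simp
  also have "\<dots> \<le> 3 * (a\<^sup>2 + b\<^sup>2 + c\<^sup>2) * (K + K)"
    using b by (intro mult_left_mono add_mono) auto
  finally show "expectation (\<lambda>\<omega>. (a * (u \<omega>)\<^sup>2 + b * (u \<omega> * v \<omega>) + c * (v \<omega>)\<^sup>2)\<^sup>2)
      \<le> 6 * (a\<^sup>2 + b\<^sup>2 + c\<^sup>2) * K" by (simp add: algebra_simps)
qed

text \<open>
  The processes \<open>e\<close> and \<open>x\<close> obey the recursions of the theorem but start at zero, which makes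
  them functions of the noise alone.
\<close>

locale zero_start_autoregression = centered_noise +
  fixes \<theta> \<rho> :: real
  assumes abs_\<theta>: "\<bar>\<theta>\<bar> < 1" and abs_\<rho>: "\<bar>\<rho>\<bar> < 1"
begin

primrec e :: "nat \<Rightarrow> 'a \<Rightarrow> real" where
  "e 0 \<omega> = 0"
| "e (Suc n) \<omega> = \<rho> * e n \<omega> + V (Suc n) \<omega>"

primrec x :: "nat \<Rightarrow> 'a \<Rightarrow> real" where
  "x 0 \<omega> = 0"
| "x (Suc n) \<omega> = \<theta> * x n \<omega> + e (Suc n) \<omega>"

definition C\<^sub>e :: real where "C\<^sub>e = C\<^sub>V / (1 - \<bar>\<rho>\<bar>) ^ 4"

definition C\<^sub>x :: real where "C\<^sub>x = C\<^sub>e / (1 - \<bar>\<theta>\<bar>) ^ 4"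

lemma e_moment: "integrable M (\<lambda>\<omega>. e n \<omega> ^ 4)" "expectation (\<lambda>\<omega>. e n \<omega> ^ 4) \<le> C\<^sub>e"
  and measurable_e [measurable]: "e n \<in> borel_measurable M"
  using fourth_moment_recursion[of \<rho> e "\<lambda>n. V (Suc n)" C\<^sub>V n] abs_\<rho> integrable_V4 bound_V4
  by (simp_all add: C\<^sub>e_def)

lemma x_moment: "integrable M (\<lambda>\<omega>. x n \<omega> ^ 4)" "expectation (\<lambda>\<omega>. x n \<omega> ^ 4) \<le> C\<^sub>x"
  and measurable_x [measurable]: "x n \<in> borel_measurable M"
  using fourth_moment_recursion[of \<theta> x "\<lambda>n. e (Suc n)" C\<^sub>e n] abs_\<theta> e_moment measurable_e
  by (simp_all add: C\<^sub>x_def del: e.simps)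

lemma e_past: "e n \<in> borel_measurable (past n)"
proof (induction n)
  case (Suc n)
  note [measurable] = Suc[THEN measurable_past_Suc] V_past[OF lessI]
  have "e (Suc n) = (\<lambda>\<omega>. \<rho> * e n \<omega> + V (Suc n) \<omega>)" by auto
  then show ?case by simp
next
  case 0
  have "e 0 = (\<lambda>_. 0)" by auto
  then show ?case by simp
qed

lemma x_past: "x n \<in> borel_measurable (past n)"
proof (induction n)
  case (Suc n)
  note [measurable] = Suc[THEN measurable_past_Suc] e_past
  have "(\<lambda>\<omega>. \<theta> * x n \<omega> + e (Suc n) \<omega>) \<in> borel_measurable (past (Suc n))" by measurable
  also have "(\<lambda>\<omega>. \<theta> * x n \<omega> + e (Suc n) \<omega>) = x (Suc n)" by auto
  finally show ?case .
next
  case 0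
  have "x 0 = (\<lambda>_. 0)" by auto
  then show ?case by simp
qed

text \<open>
  The coefficients of the corrector. Matching the coefficients of \<open>x\<^sup>2\<close>, \<open>x e\<close> and \<open>e\<^sup>2\<close> in the
  Poisson equation gives a triangular linear system, solved in this order (\<open>\<alpha>_eq\<close>, \<open>\<beta>_eq\<close>, \<open>\<gamma>_eq\<close>).
\<close>

definition \<alpha> :: real where "\<alpha> = 1 / (1 - \<theta>\<^sup>2)"
definition \<beta> :: real where "\<beta> = 2 * \<alpha> * \<theta> * \<rho> / (1 - \<theta> * \<rho>)"
definition \<gamma> :: real where "\<gamma> = (\<alpha> + \<beta>) * \<rho>\<^sup>2 / (1 - \<rho>\<^sup>2)"

text \<open>
  The variance of the stationary solution.
\<close>

definition limit_variance :: real where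
  "limit_variance = \<sigma>\<^sup>2 * (1 + \<theta> * \<rho>) / ((1 - \<theta>\<^sup>2) * (1 - \<theta> * \<rho>) * (1 - \<rho>\<^sup>2))"

definition G :: "nat \<Rightarrow> 'a \<Rightarrow> real" where
  "G n \<omega> = \<alpha> * (x n \<omega>)\<^sup>2 + \<beta> * (x n \<omega> * e n \<omega>) + \<gamma> * (e n \<omega>)\<^sup>2"

text \<open>
  The factor of the next noise variable in the increment of the corrector.
\<close>

definition P :: "nat \<Rightarrow> 'a \<Rightarrow> real" where
  "P n \<omega> = (2 * \<alpha> * \<theta> + \<beta> * \<theta>) * x n \<omega> + (2 * \<alpha> * \<rho> + 2 * \<beta> * \<rho> + 2 * \<gamma> * \<rho>) * e n \<omega>"

lemma sq_less_1: "\<theta>\<^sup>2 < 1" "\<rho>\<^sup>2 < 1" "\<bar>\<theta> * \<rho>\<bar> < 1"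
proof -
  show "\<theta>\<^sup>2 < 1" "\<rho>\<^sup>2 < 1" using abs_\<theta> abs_\<rho> by (simp_all add: abs_square_less_1)
  show "\<bar>\<theta> * \<rho>\<bar> < 1" using mult_strict_mono'[OF abs_\<theta> abs_\<rho>] by (simp add: abs_mult)
qed

lemma limit_variance_nonneg: "0 \<le> limit_variance"
  using sq_less_1 by (auto simp: limit_variance_def abs_less_iff)

lemma \<alpha>_eq: "\<alpha> * \<theta>\<^sup>2 = \<alpha> - 1"
  using sq_less_1(1) by (simp add: \<alpha>_def field_simps)

lemma \<beta>_eq: "2 * \<alpha> * \<theta> * \<rho> + \<beta> * \<theta> * \<rho> = \<beta>"
proof -
  have "\<beta> * (1 - \<theta> * \<rho>) = 2 * \<alpha> * \<theta> * \<rho>"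
    using sq_less_1(3) by (simp add: \<beta>_def)
  then show ?thesis by (simp add: algebra_simps)
qed

lemma \<gamma>_eq: "\<alpha> * \<rho>\<^sup>2 + \<beta> * \<rho>\<^sup>2 + \<gamma> * \<rho>\<^sup>2 = \<gamma>"
proof -
  have "\<gamma> * (1 - \<rho>\<^sup>2) = (\<alpha> + \<beta>) * \<rho>\<^sup>2"
    using sq_less_1(2) by (simp add: \<gamma>_def)
  then show ?thesis by (simp add: algebra_simps)
qed

text \<open>
  The constant term of the Poisson equation: it identifies the limit of the averages of \<open>x\<^sup>2\<close>.
\<close>

lemma limit_variance_eq: "(\<alpha> + \<beta> + \<gamma>) * \<sigma>\<^sup>2 = limit_variance"
proof -
  have n: "1 - \<theta> * \<rho> \<noteq> 0" "1 - \<rho>\<^sup>2 \<noteq> 0" "1 - \<theta>\<^sup>2 \<noteq> 0" using sq_less_1 by auto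
  have "(\<alpha> + \<beta>) * (1 - \<theta> * \<rho>) = \<alpha> * (1 + \<theta> * \<rho>)"
    using n by (simp add: \<beta>_def field_simps)
  then have ab: "\<alpha> + \<beta> = \<alpha> * (1 + \<theta> * \<rho>) / (1 - \<theta> * \<rho>)" using n by (simp add: eq_divide_eq)
  have "\<alpha> + \<beta> + \<gamma> = (\<alpha> + \<beta>) / (1 - \<rho>\<^sup>2)"
    using n by (simp add: \<gamma>_def field_simps)
  then have "\<alpha> + \<beta> + \<gamma> = \<alpha> * (1 + \<theta> * \<rho>) / (1 - \<theta> * \<rho>) / (1 - \<rho>\<^sup>2)"
    by (simp only: ab)
  then show ?thesis by (simp add: limit_variance_def \<alpha>_def)
qed

lemma corrector_identity:
  "G (Suc n) \<omega> = G n \<omega> - ((x n \<omega>)\<^sup>2 - limit_variance)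
    + P n \<omega> * V (Suc n) \<omega> + (\<alpha> + \<beta> + \<gamma>) * ((V (Suc n) \<omega>)\<^sup>2 - \<sigma>\<^sup>2)"
proof -
  define X E W where "X = x n \<omega>" and "E = e n \<omega>" and "W = V (Suc n) \<omega>"
  have "G (Suc n) \<omega> = \<alpha> * \<theta>\<^sup>2 * X\<^sup>2 + (2 * \<alpha> * \<theta> * \<rho> + \<beta> * \<theta> * \<rho>) * (X * E)
      + (\<alpha> * \<rho>\<^sup>2 + \<beta> * \<rho>\<^sup>2 + \<gamma> * \<rho>\<^sup>2) * E\<^sup>2 + P n \<omega> * W + (\<alpha> + \<beta> + \<gamma>) * W\<^sup>2"
    by (simp add: G_def P_def X_def E_def W_def power2_eq_square algebra_simps)
  also have "\<dots> = (\<alpha> - 1) * X\<^sup>2 + \<beta> * (X * E) + \<gamma> * E\<^sup>2 + P n \<omega> * W + (\<alpha> + \<beta> + \<gamma>) * W\<^sup>2"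
    by (simp only: \<alpha>_eq \<beta>_eq \<gamma>_eq)
  finally show ?thesis
    by (simp add: G_def X_def E_def W_def algebra_simps flip: limit_variance_eq)
qed

text \<open>
  A common bound for the fourth moments of \<open>x\<close> and the second moments of \<open>G\<close> and \<open>P\<close>; its
  summands are chosen to dominate these one after the other.
\<close>

definition C :: real where
  "C = C\<^sub>x + 6 * (\<alpha>\<^sup>2 + \<beta>\<^sup>2 + \<gamma>\<^sup>2) * (C\<^sub>x + C\<^sub>e)
    + (2 * (2 * \<alpha> * \<theta> + \<beta> * \<theta>)\<^sup>2 + 2 * (2 * \<alpha> * \<rho> + 2 * \<beta> * \<rho> + 2 * \<gamma> * \<rho>)\<^sup>2) * (2 + C\<^sub>x + C\<^sub>e)"

lemma C_pos: "0 \<le> C\<^sub>e" "0 \<le> C\<^sub>x"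
  by (rule order_trans[OF _ e_moment(2)[of 0]], simp)
     (rule order_trans[OF _ x_moment(2)[of 0]], simp)

lemma G_moment: "integrable M (\<lambda>\<omega>. (G n \<omega>)\<^sup>2)" "expectation (\<lambda>\<omega>. (G n \<omega>)\<^sup>2) \<le> C"
proof -
  have b: "expectation (\<lambda>\<omega>. x n \<omega> ^ 4) \<le> C\<^sub>x + C\<^sub>e" "expectation (\<lambda>\<omega>. e n \<omega> ^ 4) \<le> C\<^sub>x + C\<^sub>e"
    using x_moment(2)[of n] e_moment(2)[of n] C_pos by linarith+
  note q = square_of_quadratic_form[OF measurable_x measurable_e x_moment(1) e_moment(1) b, of \<alpha> \<beta> \<gamma>]
  show "integrable M (\<lambda>\<omega>. (G n \<omega>)\<^sup>2)" unfolding G_def by (rule q(1))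
  have "expectation (\<lambda>\<omega>. (G n \<omega>)\<^sup>2) \<le> 6 * (\<alpha>\<^sup>2 + \<beta>\<^sup>2 + \<gamma>\<^sup>2) * (C\<^sub>x + C\<^sub>e)"
    unfolding G_def by (rule q(2))
  also have "\<dots> \<le> C" using C_pos by (simp add: C_def)
  finally show "expectation (\<lambda>\<omega>. (G n \<omega>)\<^sup>2) \<le> C" .
qed

lemma P_moment: "integrable M (\<lambda>\<omega>. (P n \<omega>)\<^sup>2)" "expectation (\<lambda>\<omega>. (P n \<omega>)\<^sup>2) \<le> C"
proof -
  define a b where "a = 2 * \<alpha> * \<theta> + \<beta> * \<theta>" and "b = 2 * \<alpha> * \<rho> + 2 * \<beta> * \<rho> + 2 * \<gamma> * \<rho>"
  have bound: "(P n \<omega>)\<^sup>2 \<le> (2 * a\<^sup>2 + 2 * b\<^sup>2) * (2 + x n \<omega> ^ 4 + e n \<omega> ^ 4)" for \<omega>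
  proof -
    have "(P n \<omega>)\<^sup>2 \<le> 2 * a\<^sup>2 * (x n \<omega>)\<^sup>2 + 2 * b\<^sup>2 * (e n \<omega>)\<^sup>2"
      using sum_squares_bound[of "a * x n \<omega>" "b * e n \<omega>"]
      by (simp add: P_def a_def[symmetric] b_def[symmetric] power2_sum power_mult_distrib)
    also have "\<dots> \<le> 2 * a\<^sup>2 * (2 + x n \<omega> ^ 4 + e n \<omega> ^ 4) + 2 * b\<^sup>2 * (2 + x n \<omega> ^ 4 + e n \<omega> ^ 4)"
    proof -
      have "0 \<le> x n \<omega> ^ 4" "0 \<le> e n \<omega> ^ 4" by simp_all
      with square_le_one_plus_fourth[of "x n \<omega>"] square_le_one_plus_fourth[of "e n \<omega>"]
      have "(x n \<omega>)\<^sup>2 \<le> 2 + x n \<omega> ^ 4 + e n \<omega> ^ 4" "(e n \<omega>)\<^sup>2 \<le> 2 + x n \<omega> ^ 4 + e n \<omega> ^ 4"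
        by linarith+
      then show ?thesis by (intro add_mono mult_left_mono) auto
    qed
    finally show ?thesis by (simp add: algebra_simps)
  qed
  have i: "integrable M (\<lambda>\<omega>. (2 * a\<^sup>2 + 2 * b\<^sup>2) * (2 + x n \<omega> ^ 4 + e n \<omega> ^ 4))"
    using x_moment(1)[of n] e_moment(1)[of n] by simp
  have [measurable]: "P n \<in> borel_measurable M" unfolding P_def[abs_def] by measurable
  show int: "integrable M (\<lambda>\<omega>. (P n \<omega>)\<^sup>2)"
    by (rule Bochner_Integration.integrable_bound[OF i])
       (simp, simp only: real_norm_def abs_power2 order_trans[OF bound abs_ge_self] AE_I2)
  have "expectation (\<lambda>\<omega>. (P n \<omega>)\<^sup>2)
      \<le> expectation (\<lambda>\<omega>. (2 * a\<^sup>2 + 2 * b\<^sup>2) * (2 + x n \<omega> ^ 4 + e n \<omega> ^ 4))"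
    by (intro integral_mono int i bound)
  also have "\<dots> = (2 * a\<^sup>2 + 2 * b\<^sup>2) * (2 + expectation (\<lambda>\<omega>. x n \<omega> ^ 4) + expectation (\<lambda>\<omega>. e n \<omega> ^ 4))"
    using x_moment(1)[of n] e_moment(1)[of n] by (simp add: prob_space)
  also have "\<dots> \<le> (2 * a\<^sup>2 + 2 * b\<^sup>2) * (2 + C\<^sub>x + C\<^sub>e)"
    using x_moment(2)[of n] e_moment(2)[of n] by (intro mult_left_mono) auto
  also have "\<dots> \<le> C" using C_pos by (simp add: C_def a_def b_def)
  finally show "expectation (\<lambda>\<omega>. (P n \<omega>)\<^sup>2) \<le> C" .
qed

sublocale corrected_transform M V \<sigma> C\<^sub>V x G P "\<alpha> + \<beta> + \<gamma>" limit_variance C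
proof
  note [measurable] = x_past e_past
  show "G k \<in> borel_measurable (past k)" for k unfolding G_def[abs_def] by measurable
  show "P k \<in> borel_measurable (past k)" for k unfolding P_def[abs_def] by measurable
  show "expectation (\<lambda>\<omega>. x k \<omega> ^ 4) \<le> C" for k
    using x_moment(2)[of k] C_pos unfolding C_def by (smt (verit) mult_nonneg_nonneg zero_le_power2)
qed (fact x_past x_moment(1) G_moment P_moment corrector_identity limit_variance_nonneg)+

end

section \<open>Characteristic function of the limit law\<close>

lemma char_centered_normal:
  assumes "0 < v"
  shows "char (centered_normal v) t = of_real (exp (- (v * t\<^sup>2) / 2))"
proof -
  define s where "s = sqrt v"
  have s: "0 < s" and sv: "s\<^sup>2 = v" using assms by (simp_all add: s_def)
  have scale: "s * normal_density 0 s (s * x) = std_normal_density x" for x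
    using s by (simp add: normal_density_def real_sqrt_mult power_mult_distrib)
  have "char (centered_normal v) t = (CLINT x|lborel. normal_density 0 s x *\<^sub>R iexp (t * x))"
    unfolding char_def centered_normal_def s_def[symmetric]
    by (subst integral_density) (auto simp: normal_density_nonneg)
  also have "\<dots> = \<bar>s\<bar> *\<^sub>R (CLINT x|lborel. normal_density 0 s (0 + s * x) *\<^sub>R iexp (t * (0 + s * x)))"
    using s by (intro lborel_integral_real_affine) simp
  also have "\<dots> = (CLINT x|lborel. std_normal_density x *\<^sub>R iexp ((t * s) * x))"
    using s by (simp add: mult.assoc flip: scale integral_scaleR_right)
  also have "\<dots> = char std_normal_distribution (t * s)"
    unfolding char_def by (subst integral_density) (auto simp: normal_density_nonneg mult.assoc)
  also have "\<dots> = of_real (exp (- (v * t\<^sup>2) / 2))"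
    by (simp add: char_std_normal_distribution power_mult_distrib sv mult.commute)
  finally show ?thesis .
qed

lemma real_distribution_centered_normal: "0 < v \<Longrightarrow> real_distribution (centered_normal v)"
  using prob_space_normal_density[of "sqrt v" 0]
  by (auto simp: centered_normal_def real_distribution_def real_distribution_axioms_def)

section \<open>Arbitrary initial values and the estimation error\<close>

locale autoregression = zero_start_autoregression +
  fixes X \<epsilon> :: "nat \<Rightarrow> 'a \<Rightarrow> real"
  assumes X0 [measurable]: "X 0 \<in> borel_measurable M"
    and \<epsilon>0 [measurable]: "\<epsilon> 0 \<in> borel_measurable M"
    and X_Suc: "\<And>n \<omega>. \<omega> \<in> space M \<Longrightarrow> X (Suc n) \<omega> = \<theta> * X n \<omega> + \<epsilon> (Suc n) \<omega>"
    and \<epsilon>_Suc: "\<And>n \<omega>. \<omega> \<in> space M \<Longrightarrow> \<epsilon> (Suc n) \<omega> = \<rho> * \<epsilon> n \<omega> + V (Suc n) \<omega>"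
    and \<sigma>_pos: "0 < \<sigma>\<^sup>2"
begin

lemma measurable_\<epsilon> [measurable]: "\<epsilon> n \<in> borel_measurable M"
proof (induction n)
  case (Suc n)
  note [measurable] = Suc
  have "(\<lambda>\<omega>. \<rho> * \<epsilon> n \<omega> + V (Suc n) \<omega>) \<in> borel_measurable M" by measurable
  then show ?case by (rule measurable_cong[THEN iffD1, rotated]) (simp add: \<epsilon>_Suc)
qed simp

lemma measurable_X [measurable]: "X n \<in> borel_measurable M"
proof (induction n)
  case (Suc n)
  note [measurable] = Suc
  have "(\<lambda>\<omega>. \<theta> * X n \<omega> + \<epsilon> (Suc n) \<omega>) \<in> borel_measurable M" by measurable
  then show ?case by (rule measurable_cong[THEN iffD1, rotated]) (simp add: X_Suc)
qed simp

text \<open>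
  Any number strictly between \<open>max \<bar>\<theta>\<bar> \<bar>\<rho>\<bar>\<close> and 1 would do. The strict inequality absorbs the
  factor \<open>n\<close> that appears in \<open>\<Sum>j<n. \<theta>\<^sup>j \<rho>\<^bsup>n-j\<^esup>\<close> when \<open>\<theta> = \<rho>\<close>.
\<close>

definition rate :: real where "rate = (1 + max \<bar>\<theta>\<bar> \<bar>\<rho>\<bar>) / 2"

text \<open>
  The constant for which the bound \<open>K rate\<^sup>n\<close> on the influence of the initial values
  reproduces itself under the recursion of \<open>X\<close>: it solves \<open>\<bar>\<theta>\<bar> K + rate = K rate\<close>.
\<close>

definition K :: real where "K = rate / (rate - \<bar>\<theta>\<bar>)"

definition W :: "'a \<Rightarrow> real" where "W \<omega> = K * (\<bar>X 0 \<omega>\<bar> + \<bar>\<epsilon> 0 \<omega>\<bar>)"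

lemma measurable_W [measurable]: "W \<in> borel_measurable M"
  unfolding W_def[abs_def] by measurable

lemma rate: "\<bar>\<theta>\<bar> < rate" "\<bar>\<rho>\<bar> < rate" "0 < rate" "rate < 1"
  using abs_\<theta> abs_\<rho> by (auto simp: rate_def max_def field_simps)

lemma K: "1 \<le> K" "\<bar>\<theta>\<bar> * K + rate = K * rate"
proof -
  have pos: "0 < rate - \<bar>\<theta>\<bar>" using rate by simp
  then show "1 \<le> K" by (simp add: K_def le_divide_eq)
  from pos have "K * (rate - \<bar>\<theta>\<bar>) = rate" by (simp add: K_def)
  then show "\<bar>\<theta>\<bar> * K + rate = K * rate" by (simp add: algebra_simps)
qed

lemma W_nonneg: "0 \<le> W \<omega>"
  using K by (simp add: W_def)

lemma \<epsilon>_diff: "\<omega> \<in> space M \<Longrightarrow> \<epsilon> n \<omega> - e n \<omega> = \<rho> ^ n * \<epsilon> 0 \<omega>"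
  by (induction n) (simp_all add: \<epsilon>_Suc algebra_simps)

lemma \<epsilon>_close: "\<omega> \<in> space M \<Longrightarrow> \<bar>\<epsilon> n \<omega> - e n \<omega>\<bar> \<le> rate ^ n * (\<bar>X 0 \<omega>\<bar> + \<bar>\<epsilon> 0 \<omega>\<bar>)"
  unfolding \<epsilon>_diff abs_mult power_abs
  using rate by (intro mult_mono power_mono) auto

lemma X_close: "\<omega> \<in> space M \<Longrightarrow> \<bar>X n \<omega> - x n \<omega>\<bar> \<le> rate ^ n * W \<omega>"
proof (induction n)
  case 0
  have "1 * \<bar>X 0 \<omega>\<bar> \<le> K * (\<bar>X 0 \<omega>\<bar> + \<bar>\<epsilon> 0 \<omega>\<bar>)"
    using K by (intro mult_mono) auto
  then show ?case by (simp add: W_def)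
next
  case (Suc n)
  \<comment> \<open>The deviation obeys the same recursion, driven by the geometrically small deviation of the noise.\<close>
  define I where "I = \<bar>X 0 \<omega>\<bar> + \<bar>\<epsilon> 0 \<omega>\<bar>"
  have "X (Suc n) \<omega> - x (Suc n) \<omega> = \<theta> * (X n \<omega> - x n \<omega>) + (\<epsilon> (Suc n) \<omega> - e (Suc n) \<omega>)"
    using Suc.prems by (simp add: X_Suc algebra_simps del: e.simps)
  then have "\<bar>X (Suc n) \<omega> - x (Suc n) \<omega>\<bar> \<le> \<bar>\<theta>\<bar> * \<bar>X n \<omega> - x n \<omega>\<bar> + \<bar>\<epsilon> (Suc n) \<omega> - e (Suc n) \<omega>\<bar>"
    by (metis abs_mult abs_triangle_ineq)
  also have "\<dots> \<le> \<bar>\<theta>\<bar> * (rate ^ n * W \<omega>) + rate ^ Suc n * I"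
    using Suc \<epsilon>_close[OF Suc.prems, of "Suc n"] by (intro add_mono mult_left_mono) (auto simp: I_def)
  also have "\<dots> = rate ^ n * ((\<bar>\<theta>\<bar> * K + rate) * I)"
    by (simp add: W_def I_def algebra_simps)
  also have "\<dots> = rate ^ Suc n * W \<omega>" by (simp add: K W_def I_def)
  finally show ?case .
qed

lemma first_moments:
  "integrable M (x n)" "integrable M (e n)" "expectation (\<lambda>\<omega>. \<bar>x n \<omega>\<bar>) \<le> 2 + C\<^sub>x"
  "expectation (\<lambda>\<omega>. \<bar>e n \<omega>\<bar>) \<le> 2 + C\<^sub>e" "expectation (\<lambda>\<omega>. \<bar>V (Suc n) \<omega>\<bar>) \<le> 2 + C\<^sub>V"
proof -
  have abs_le: "\<bar>a\<bar> \<le> 2 + a ^ 4" for a :: real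
    using abs_le_one_plus_square[of a] square_le_one_plus_fourth[of a] by linarith
  have gen: "integrable M f" "expectation (\<lambda>\<omega>. \<bar>f \<omega>\<bar>) \<le> 2 + c"
    if [measurable]: "f \<in> borel_measurable M" and i: "integrable M (\<lambda>\<omega>. f \<omega> ^ 4)"
      and b: "expectation (\<lambda>\<omega>. f \<omega> ^ 4) \<le> c" for f :: "'a \<Rightarrow> real" and c
  proof -
    have j: "integrable M (\<lambda>\<omega>. 2 + f \<omega> ^ 4)" using i by simp
    show f: "integrable M f"
      by (rule Bochner_Integration.integrable_bound[OF j])
         (simp, simp only: real_norm_def order_trans[OF abs_le abs_ge_self] AE_I2)
    have "expectation (\<lambda>\<omega>. \<bar>f \<omega>\<bar>) \<le> expectation (\<lambda>\<omega>. 2 + f \<omega> ^ 4)"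
      using f by (intro integral_mono j abs_le) simp
    also have "\<dots> \<le> 2 + c" using i b by (simp add: prob_space)
    finally show "expectation (\<lambda>\<omega>. \<bar>f \<omega>\<bar>) \<le> 2 + c" .
  qed
  show "integrable M (x n)" "expectation (\<lambda>\<omega>. \<bar>x n \<omega>\<bar>) \<le> 2 + C\<^sub>x"
    using gen[OF measurable_x x_moment] by blast+
  show "integrable M (e n)" "expectation (\<lambda>\<omega>. \<bar>e n \<omega>\<bar>) \<le> 2 + C\<^sub>e"
    using gen[OF measurable_e e_moment] by blast+
  show "expectation (\<lambda>\<omega>. \<bar>V (Suc n) \<omega>\<bar>) \<le> 2 + C\<^sub>V"
    using gen[OF measurable_V integrable_V4 bound_V4] by blast
qed

text \<open>
  The contributions of the initial values to numerator and denominator are dominated by such weighted sums,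
  whose means are bounded uniformly in \<open>n\<close>.
\<close>

lemma bounded_geometric_sum:
  assumes i: "\<And>n. integrable M (y n)" and b: "\<And>n. expectation (\<lambda>\<omega>. \<bar>y n \<omega>\<bar>) \<le> c"
  shows "bounded_in_prob (\<lambda>n \<omega>. \<Sum>k<n. rate ^ k * \<bar>y k \<omega>\<bar>)"
proof (rule bounded_in_prob_of_mean)
  show "integrable M (\<lambda>\<omega>. \<Sum>k<n. rate ^ k * \<bar>y k \<omega>\<bar>)" for n
    using i by (intro Bochner_Integration.integrable_sum integrable_mult_right) auto
  have c: "0 \<le> c" using b[of 0] by (rule order_trans[rotated]) simp
  fix n
  have "expectation (\<lambda>\<omega>. \<bar>\<Sum>k<n. rate ^ k * \<bar>y k \<omega>\<bar>\<bar>) = expectation (\<lambda>\<omega>. \<Sum>k<n. rate ^ k * \<bar>y k \<omega>\<bar>)"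
    using rate by (intro Bochner_Integration.integral_cong refl abs_of_nonneg sum_nonneg) simp
  also have "\<dots> = (\<Sum>k<n. rate ^ k * expectation (\<lambda>\<omega>. \<bar>y k \<omega>\<bar>))"
    using i by (subst Bochner_Integration.integral_sum) (auto intro!: integrable_mult_right)
  also have "\<dots> \<le> (\<Sum>k<n. rate ^ k * c)"
    using b rate by (intro sum_mono mult_left_mono) auto
  also have "\<dots> \<le> (1 / (1 - rate)) * c"
  proof -
    have "(\<Sum>k<n. rate ^ k) = (1 - rate ^ n) / (1 - rate)"
      using rate by (subst sum_gp_strict) simp
    also have "\<dots> \<le> 1 / (1 - rate)" using rate by (intro divide_right_mono) auto
    finally show ?thesis using mult_right_mono[OF _ c] by (simp only: sum_distrib_right[symmetric])
  qed
  finally show "expectation (\<lambda>\<omega>. \<bar>\<Sum>k<n. rate ^ k * \<bar>y k \<omega>\<bar>\<bar>) \<le> (1 / (1 - rate)) * c" .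
qed

definition S :: "nat \<Rightarrow> 'a \<Rightarrow> real" where "S n \<omega> = (\<Sum>k<n. (X k \<omega>)\<^sup>2)"
definition mart :: "nat \<Rightarrow> 'a \<Rightarrow> real" where "mart n \<omega> = (\<Sum>k<n. X k \<omega> * V (Suc k) \<omega>)"
definition boundary :: "nat \<Rightarrow> 'a \<Rightarrow> real" where "boundary n \<omega> = (X n \<omega>)\<^sup>2 - \<epsilon> n \<omega> * X n \<omega>"

lemma measurable_S [measurable]: "S n \<in> borel_measurable M"
  and measurable_mart [measurable]: "mart n \<in> borel_measurable M"
  and measurable_boundary [measurable]: "boundary n \<in> borel_measurable M"
  unfolding S_def[abs_def] mart_def[abs_def] boundary_def[abs_def] by measurable

text \<open>
  From \<open>X\<^bsub>n+1\<^esub> = \<theta> X\<^sub>n + \<rho> \<epsilon>\<^sub>n + V\<^bsub>n+1\<^esub>\<close> one gets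
  \<open>X\<^bsub>n+1\<^esub> X\<^sub>n = \<theta> X\<^sub>n\<^sup>2 + \<rho> \<epsilon>\<^sub>n X\<^sub>n + X\<^sub>n V\<^bsub>n+1\<^esub>\<close>.
  Since \<open>X\<^bsub>n+1\<^esub>\<^sup>2 - \<epsilon>\<^bsub>n+1\<^esub> X\<^bsub>n+1\<^esub> = \<theta> X\<^bsub>n+1\<^esub> X\<^sub>n\<close>,
  the unobserved products \<open>\<epsilon>\<^sub>n X\<^sub>n\<close> reduce to the numerator and the denominator themselves, up to a telescoping sum.
\<close>

lemma numerator_identity:
  assumes "\<omega> \<in> space M"
  shows "(1 + \<theta> * \<rho>) * (\<Sum>k<n. X (Suc k) \<omega> * X k \<omega>)
    = (\<theta> + \<rho>) * S n \<omega> + mart n \<omega> + \<rho> * (boundary n \<omega> - boundary 0 \<omega>)"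
proof (induction n)
  case (Suc n)
  have "(1 + \<theta> * \<rho>) * (X (Suc n) \<omega> * X n \<omega>)
    = (\<theta> + \<rho>) * (X n \<omega>)\<^sup>2 + X n \<omega> * V (Suc n) \<omega> + \<rho> * (boundary (Suc n) \<omega> - boundary n \<omega>)"
    using assms by (simp add: boundary_def X_Suc \<epsilon>_Suc power2_eq_square algebra_simps)
  with Suc show ?case by (simp add: S_def mart_def algebra_simps)
qed (simp add: S_def mart_def)

lemma bounded_W: "bounded_in_prob (\<lambda>n. W)"
  by (rule bounded_in_prob_const) simp

lemma bounded_const: "bounded_in_prob (\<lambda>n \<omega>. c)"
  using bounded_in_prob_const[of "\<lambda>_. c"] by simp

lemma bounded_mart_diff: "bounded_in_prob (\<lambda>n \<omega>. mart n \<omega> - transform n \<omega>)"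
proof (rule bounded_in_prob_dominated)
  show "bounded_in_prob (\<lambda>n \<omega>. W \<omega> * (\<Sum>k<n. rate ^ k * \<bar>V (Suc k) \<omega>\<bar>))"
    by (intro bounded_in_prob_mult bounded_W bounded_geometric_sum[OF integrable_V first_moments(5)])
  fix n \<omega> assume \<omega>: "\<omega> \<in> space M"
  have "\<bar>mart n \<omega> - transform n \<omega>\<bar> = \<bar>\<Sum>k<n. (X k \<omega> - x k \<omega>) * V (Suc k) \<omega>\<bar>"
    by (simp add: mart_def transform_def sum_subtractf left_diff_distrib)
  also have "\<dots> \<le> (\<Sum>k<n. \<bar>(X k \<omega> - x k \<omega>) * V (Suc k) \<omega>\<bar>)" by (rule sum_abs)
  also have "\<dots> \<le> (\<Sum>k<n. rate ^ k * W \<omega> * \<bar>V (Suc k) \<omega>\<bar>)"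
    unfolding abs_mult by (intro sum_mono mult_right_mono X_close \<omega>) simp
  also have "\<dots> = W \<omega> * (\<Sum>k<n. rate ^ k * \<bar>V (Suc k) \<omega>\<bar>)"
    by (simp add: sum_distrib_left mult_ac)
  also have "\<dots> \<le> \<bar>\<dots>\<bar>" by simp
  finally show "\<bar>mart n \<omega> - transform n \<omega>\<bar> \<le> \<bar>W \<omega> * (\<Sum>k<n. rate ^ k * \<bar>V (Suc k) \<omega>\<bar>)\<bar>" .
qed simp

lemma bounded_S_diff: "bounded_in_prob (\<lambda>n \<omega>. S n \<omega> - (\<Sum>k<n. (x k \<omega>)\<^sup>2))"
proof (rule bounded_in_prob_dominated)
  have c: "bounded_in_prob (\<lambda>n \<omega>. \<Sum>k<n. rate ^ k * \<bar>1\<bar>)"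
    by (rule bounded_geometric_sum[of "\<lambda>_ _. 1" 1]) (simp_all add: prob_space)
  show "bounded_in_prob (\<lambda>n \<omega>. W \<omega> * (2 * (\<Sum>k<n. rate ^ k * \<bar>x k \<omega>\<bar>) + W \<omega> * (\<Sum>k<n. rate ^ k * \<bar>1\<bar>)))"
    by (intro bounded_in_prob_mult bounded_in_prob_add bounded_W c bounded_const
        bounded_geometric_sum[OF first_moments(1,3)])
  fix n \<omega> assume \<omega>: "\<omega> \<in> space M"
  have "\<bar>S n \<omega> - (\<Sum>k<n. (x k \<omega>)\<^sup>2)\<bar> = \<bar>\<Sum>k<n. (X k \<omega> - x k \<omega>) * (2 * x k \<omega> + (X k \<omega> - x k \<omega>))\<bar>"
    unfolding S_def sum_subtractf[symmetric]
    by (intro arg_cong[where f=abs] sum.cong refl) (simp add: power2_eq_square algebra_simps)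
  also have "\<dots> \<le> (\<Sum>k<n. \<bar>(X k \<omega> - x k \<omega>) * (2 * x k \<omega> + (X k \<omega> - x k \<omega>))\<bar>)" by (rule sum_abs)
  also have "\<dots> \<le> (\<Sum>k<n. rate ^ k * W \<omega> * (2 * \<bar>x k \<omega>\<bar> + W \<omega>))"
    unfolding abs_mult
  proof (intro sum_mono mult_mono X_close \<omega>)
    fix k
    have "rate ^ k * W \<omega> \<le> 1 * W \<omega>"
      using rate W_nonneg by (intro mult_right_mono power_le_one) auto
    then have "\<bar>X k \<omega> - x k \<omega>\<bar> \<le> W \<omega>" using X_close[OF \<omega>, of k] by simp
    then show "\<bar>2 * x k \<omega> + (X k \<omega> - x k \<omega>)\<bar> \<le> 2 * \<bar>x k \<omega>\<bar> + W \<omega>" by linarith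
  qed (use rate W_nonneg in auto)
  also have "\<dots> = W \<omega> * (2 * (\<Sum>k<n. rate ^ k * \<bar>x k \<omega>\<bar>) + W \<omega> * (\<Sum>k<n. rate ^ k * \<bar>1\<bar>))"
    by (simp add: sum_distrib_left sum.distrib[symmetric] algebra_simps)
  also have "\<dots> \<le> \<bar>\<dots>\<bar>" by (rule abs_ge_self)
  finally show "\<bar>S n \<omega> - (\<Sum>k<n. (x k \<omega>)\<^sup>2)\<bar>
    \<le> \<bar>W \<omega> * (2 * (\<Sum>k<n. rate ^ k * \<bar>x k \<omega>\<bar>) + W \<omega> * (\<Sum>k<n. rate ^ k * \<bar>1\<bar>))\<bar>" .
qed simp

lemma bounded_boundary: "bounded_in_prob boundary"
proof -
  have close: "bounded_in_prob Y" if y: "bounded_in_prob y" and [measurable]: "\<And>n. Y n \<in> borel_measurable M"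
    and yY: "\<And>n \<omega>. \<omega> \<in> space M \<Longrightarrow> \<bar>Y n \<omega> - y n \<omega>\<bar> \<le> W \<omega>" for y Y :: "nat \<Rightarrow> 'a \<Rightarrow> real"
  proof -
    note [measurable] = bounded_in_prob_measurable[OF y]
    have "bounded_in_prob (\<lambda>n \<omega>. Y n \<omega> - y n \<omega>)"
      by (rule bounded_in_prob_dominated[OF bounded_W]) (auto intro: order_trans[OF yY])
    from bounded_in_prob_add[OF y this] show ?thesis by simp
  qed
  have x: "bounded_in_prob x" by (rule bounded_in_prob_of_mean[OF first_moments(1,3)])
  have e: "bounded_in_prob e" by (rule bounded_in_prob_of_mean[OF first_moments(2,4)])
  have X: "bounded_in_prob X"
  proof (rule close[OF x])
    fix n \<omega> assume \<omega>: "\<omega> \<in> space M"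
    have "rate ^ n * W \<omega> \<le> 1 * W \<omega>"
      using rate W_nonneg by (intro mult_right_mono power_le_one) auto
    then show "\<bar>X n \<omega> - x n \<omega>\<bar> \<le> W \<omega>" using X_close[OF \<omega>, of n] by simp
  qed simp
  have \<epsilon>: "bounded_in_prob \<epsilon>"
  proof (rule close[OF e])
    fix n \<omega> assume \<omega>: "\<omega> \<in> space M"
    have "rate ^ n * (\<bar>X 0 \<omega>\<bar> + \<bar>\<epsilon> 0 \<omega>\<bar>) \<le> K * (\<bar>X 0 \<omega>\<bar> + \<bar>\<epsilon> 0 \<omega>\<bar>)"
      using rate K by (intro mult_right_mono order_trans[OF power_le_one]) auto
    then show "\<bar>\<epsilon> n \<omega> - e n \<omega>\<bar> \<le> W \<omega>" using \<epsilon>_close[OF \<omega>, of n] by (simp add: W_def)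
  qed simp
  have "bounded_in_prob (\<lambda>n \<omega>. X n \<omega> * (X n \<omega> + (-1) * \<epsilon> n \<omega>))"
    by (intro bounded_in_prob_mult bounded_in_prob_add X \<epsilon> bounded_const)
  then show ?thesis
    by (rule bounded_in_prob_dominated) (auto simp: boundary_def power2_eq_square algebra_simps)
qed

lemma limit_variance_pos: "0 < limit_variance"
  using sq_less_1 \<sigma>_pos by (auto simp: limit_variance_def abs_less_iff intro!: divide_pos_pos mult_pos_pos)

lemma one_plus_pos: "0 < 1 + \<theta> * \<rho>"
  using sq_less_1(3) by (auto simp: abs_less_iff)

text \<open>
  The law of large numbers for the zero-start process, transferred to \<open>X\<close> by
  \<open>bounded_S_diff\<close>. At \<open>n = 0\<close> the quotient is zero by convention; the term with the case
  distinction in the proof corrects this single value.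
\<close>

lemma vanishing_S: "vanishing (\<lambda>n \<omega>. (1 + \<theta> * \<rho>) * S n \<omega> / real n - (1 + \<theta> * \<rho>) * limit_variance)"
proof -
  define D where "D n \<omega> = (\<Sum>k<n. (x k \<omega>)\<^sup>2 - limit_variance)" for n \<omega>
  have [measurable]: "D n \<in> borel_measurable M" for n unfolding D_def[abs_def] by measurable
  obtain B where i: "\<And>n. integrable M (\<lambda>\<omega>. (D n \<omega>)\<^sup>2)"
    and b: "\<And>n. expectation (\<lambda>\<omega>. (D n \<omega>)\<^sup>2) \<le> B * (1 + real n)"
    using sum_square_deviation unfolding D_def by blast
  have a: "vanishing (\<lambda>n \<omega>. D n \<omega> / real n)"
  proof (rule vanishing_of_mean_square)
    show "integrable M (\<lambda>\<omega>. (D n \<omega> / real n)\<^sup>2)" for n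
      using i by (simp add: power_divide)
    show "(\<lambda>n. expectation (\<lambda>\<omega>. (D n \<omega> / real n)\<^sup>2)) \<longlonglongrightarrow> 0"
    proof (rule tendsto_sandwich[OF _ _ tendsto_const])
      show "\<forall>\<^sub>F n in sequentially. 0 \<le> expectation (\<lambda>\<omega>. (D n \<omega> / real n)\<^sup>2)" by simp
      show "\<forall>\<^sub>F n in sequentially. expectation (\<lambda>\<omega>. (D n \<omega> / real n)\<^sup>2) \<le> B * ((1 + real n) / (real n)\<^sup>2)"
        using divide_right_mono[OF b, of "(real _)\<^sup>2"] by (simp add: power_divide)
      have "(\<lambda>n. (1 + real n) / (real n)\<^sup>2) \<longlonglongrightarrow> 0" by real_asymp
      from tendsto_mult_right_zero[OF this, of B]
      show "(\<lambda>n. B * ((1 + real n) / (real n)\<^sup>2)) \<longlonglongrightarrow> 0" .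
    qed
  qed measurable
  have b: "vanishing (\<lambda>n \<omega>. 1 / real n * (S n \<omega> - (\<Sum>k<n. (x k \<omega>)\<^sup>2)))"
    by (intro vanishing_mult vanishing_const bounded_S_diff) real_asymp
  have c: "vanishing (\<lambda>n \<omega>. (if n = 0 then - limit_variance else 0))"
    by (rule vanishing_const, rule tendsto_eventually, rule eventually_mono[OF eventually_gt_at_top[of 0]]) simp
  have "vanishing (\<lambda>n \<omega>. (D n \<omega> / real n + 1 / real n * (S n \<omega> - (\<Sum>k<n. (x k \<omega>)\<^sup>2))
      + (if n = 0 then - limit_variance else 0)) * (1 + \<theta> * \<rho>))"
    by (rule vanishing_mult[OF vanishing_add[OF vanishing_add[OF a b] c] bounded_const])
  also have "(\<lambda>n \<omega>. (D n \<omega> / real n + 1 / real n * (S n \<omega> - (\<Sum>k<n. (x k \<omega>)\<^sup>2))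
      + (if n = 0 then - limit_variance else 0)) * (1 + \<theta> * \<rho>))
    = (\<lambda>n \<omega>. (1 + \<theta> * \<rho>) * S n \<omega> / real n - (1 + \<theta> * \<rho>) * limit_variance)"
    by (intro ext) (simp add: D_def sum_subtractf field_simps)
  finally show ?thesis .
qed

definition numer :: "nat \<Rightarrow> 'a \<Rightarrow> real" where
  "numer n \<omega> = (mart n \<omega> + \<rho> * (boundary n \<omega> - boundary 0 \<omega>)) / sqrt (real n)"

definition denom :: "nat \<Rightarrow> 'a \<Rightarrow> real" where
  "denom n \<omega> = (1 + \<theta> * \<rho>) * S n \<omega> / real n"

definition denom_limit :: real where "denom_limit = (1 + \<theta> * \<rho>) * limit_variance"

lemma measurable_numer [measurable]: "numer n \<in> borel_measurable M"
  and measurable_denom [measurable]: "denom n \<in> borel_measurable M"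
  unfolding numer_def[abs_def] denom_def[abs_def] by measurable

lemma denom_limit_pos: "0 < denom_limit"
  using one_plus_pos limit_variance_pos by (simp add: denom_limit_def)

lemma vanishing_denom: "vanishing (\<lambda>n \<omega>. denom n \<omega> - denom_limit)"
  using vanishing_S by (simp add: denom_def denom_limit_def)

lemma vanishing_numer: "vanishing (\<lambda>n \<omega>. numer n \<omega> - transform n \<omega> / sqrt (real n))"
proof -
  have b0: "bounded_in_prob (\<lambda>n. boundary 0)" by (rule bounded_in_prob_const) simp
  have "vanishing (\<lambda>n \<omega>. 1 / sqrt (real n)
      * ((mart n \<omega> - transform n \<omega>) + \<rho> * (boundary n \<omega> + (-1) * boundary 0 \<omega>)))"
    by (intro vanishing_mult vanishing_const bounded_in_prob_add bounded_in_prob_mult bounded_const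
        bounded_mart_diff bounded_boundary b0) real_asymp
  then show ?thesis
    by (rule vanishing_dominated) (auto simp: numer_def field_simps simp flip: diff_divide_distrib)
qed

lemma bounded_transform: "bounded_in_prob (\<lambda>n \<omega>. transform n \<omega> / sqrt (real n))"
proof (rule bounded_in_prob_of_mean)
  define c where "c = 2 * (1 + C) * \<sigma>\<^sup>2"
  fix n
  have i: "integrable M (\<lambda>\<omega>. (transform n \<omega> / sqrt (real n))\<^sup>2)"
    using transform_second_moment(1)[of n] by (simp add: power_divide)
  have b: "expectation (\<lambda>\<omega>. (transform n \<omega> / sqrt (real n))\<^sup>2) \<le> c"
  proof (cases "n = 0")
    case False
    then show ?thesis
      using transform_second_moment(2)[of n] by (simp add: power_divide c_def divide_le_eq mult.commute)
  qed (use C_nonneg in \<open>simp add: c_def\<close>)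
  show i1: "integrable M (\<lambda>\<omega>. transform n \<omega> / sqrt (real n))"
    by (rule square_integrable_imp_integrable[OF _ i]) simp
  have "expectation (\<lambda>\<omega>. \<bar>transform n \<omega> / sqrt (real n)\<bar>)
      \<le> expectation (\<lambda>\<omega>. 1 + (transform n \<omega> / sqrt (real n))\<^sup>2)"
    using i by (intro integral_mono[OF integrable_abs[OF i1]] abs_le_one_plus_square) simp
  also have "\<dots> \<le> 1 + c" using i b by (simp add: prob_space)
  finally show "expectation (\<lambda>\<omega>. \<bar>transform n \<omega> / sqrt (real n)\<bar>) \<le> 1 + c" .
qed

definition error :: "nat \<Rightarrow> 'a \<Rightarrow> real" where
  "error n \<omega> = sqrt (real n) * (ls_estimator X n \<omega> - theta_star \<theta> \<rho>)"

lemma measurable_error [measurable]: "error n \<in> borel_measurable M"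
  unfolding error_def[abs_def] ls_estimator_def by measurable

lemma ls_estimator_eq: "ls_estimator X n \<omega> = (\<Sum>k<n. X (Suc k) \<omega> * X k \<omega>) / S n \<omega>"
  unfolding ls_estimator_def S_def by (simp add: sum.atLeast1_atMost_eq)

lemma error_eq:
  assumes "\<omega> \<in> space M" "S n \<omega> \<noteq> 0"
  shows "error n \<omega> = numer n \<omega> * inverse (denom n \<omega>)"
proof -
  define Z where "Z = mart n \<omega> + \<rho> * (boundary n \<omega> - boundary 0 \<omega>)"
  have n: "n \<noteq> 0" using assms(2) by (cases "n = 0") (auto simp: S_def)
  have "(\<Sum>k<n. X (Suc k) \<omega> * X k \<omega>) = ((\<theta> + \<rho>) * S n \<omega> + Z) / (1 + \<theta> * \<rho>)"
    using numerator_identity[OF assms(1), of n] one_plus_pos by (simp add: Z_def eq_divide_eq mult.commute add.assoc)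
  then have "ls_estimator X n \<omega> - theta_star \<theta> \<rho> = Z / ((1 + \<theta> * \<rho>) * S n \<omega>)"
    using assms(2) one_plus_pos by (simp add: ls_estimator_eq theta_star_def add_divide_distrib)
  then have "error n \<omega> = sqrt (real n) * (Z / ((1 + \<theta> * \<rho>) * S n \<omega>))" by (simp add: error_def)
  also have "\<dots> = Z / sqrt (real n) * (real n / ((1 + \<theta> * \<rho>) * S n \<omega>))"
  proof -
    have "w * (Z / d) = Z / w * (w * w / d)" if "w \<noteq> 0" for w d :: real
      using that by simp
    from this[of "sqrt (real n)"] n show ?thesis by simp
  qed
  finally show ?thesis by (simp add: numer_def denom_def Z_def)
qed

text \<open>
  Slutsky's argument: the quotient \<open>numer / denom\<close> differs from \<open>M\<^sub>n / (\<surd>n denom_limit)\<close> by two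
  products, each with one factor vanishing in probability and the other bounded in
  probability. The event that the denominator of the estimator is zero has vanishing
  probability, because there \<open>denom\<close> is far from its positive limit.
\<close>

lemma vanishing_error: "vanishing (\<lambda>n \<omega>. error n \<omega> - transform n \<omega> / sqrt (real n) / denom_limit)"
proof -
  have "vanishing (\<lambda>n \<omega>. error n \<omega> - numer n \<omega> * inverse (denom n \<omega>))"
  proof (rule vanishingI)
    fix \<delta> :: real assume \<delta>: "0 < \<delta>"
    have r: "0 < denom_limit / 2" using denom_limit_pos by simp
    have "prob {\<omega> \<in> space M. \<delta> < \<bar>error n \<omega> - numer n \<omega> * inverse (denom n \<omega>)\<bar>}
        \<le> prob {\<omega> \<in> space M. denom_limit / 2 < \<bar>denom n \<omega> - denom_limit\<bar>}" for n
    proof (intro finite_measure_mono subsetI)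
      fix \<omega> assume "\<omega> \<in> {\<omega> \<in> space M. \<delta> < \<bar>error n \<omega> - numer n \<omega> * inverse (denom n \<omega>)\<bar>}"
      then have "\<omega> \<in> space M" "S n \<omega> = 0" using error_eq[of \<omega> n] \<delta> by (cases "S n \<omega> = 0"; simp)+
      then show "\<omega> \<in> {\<omega> \<in> space M. denom_limit / 2 < \<bar>denom n \<omega> - denom_limit\<bar>}"
        using denom_limit_pos by (simp add: denom_def)
    qed measurable
    then show "\<exists>p. p \<longlonglongrightarrow> 0
        \<and> (\<forall>n. prob {\<omega> \<in> space M. \<delta> < \<bar>error n \<omega> - numer n \<omega> * inverse (denom n \<omega>)\<bar>} \<le> p n)"
      using vanishingD[OF vanishing_denom r] by blast
  qed measurable
  moreover have inv: "vanishing (\<lambda>n \<omega>. inverse (denom n \<omega>) - inverse denom_limit)"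
    by (rule vanishing_inverse[OF vanishing_denom denom_limit_pos]) simp
  have "bounded_in_prob numer"
  proof -
    have b0: "bounded_in_prob (\<lambda>n. boundary 0)" by (rule bounded_in_prob_const) simp
    have one: "bounded_in_prob (\<lambda>n \<omega>. 1 / sqrt (real n))"
      by (rule bounded_in_prob_dominated[OF bounded_const[of 1]]) (auto simp: divide_le_eq)
    have "bounded_in_prob (\<lambda>n \<omega>. transform n \<omega> / sqrt (real n) + 1 / sqrt (real n)
        * ((mart n \<omega> - transform n \<omega>) + \<rho> * (boundary n \<omega> + (-1) * boundary 0 \<omega>)))"
      by (intro bounded_in_prob_add bounded_in_prob_mult bounded_const
          bounded_mart_diff bounded_boundary b0 one bounded_transform)
    then show ?thesis
      by (rule bounded_in_prob_dominated) (auto simp: numer_def field_simps simp flip: add_divide_distrib diff_divide_distrib)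
  qed
  from vanishing_mult[OF inv this]
  have "vanishing (\<lambda>n \<omega>. (inverse (denom n \<omega>) - inverse denom_limit) * numer n \<omega>)" .
  moreover have "vanishing (\<lambda>n \<omega>. (numer n \<omega> - transform n \<omega> / sqrt (real n)) * inverse denom_limit)"
    by (intro vanishing_mult vanishing_numer bounded_const)
  ultimately have "vanishing (\<lambda>n \<omega>. (error n \<omega> - numer n \<omega> * inverse (denom n \<omega>))
      + (inverse (denom n \<omega>) - inverse denom_limit) * numer n \<omega>
      + (numer n \<omega> - transform n \<omega> / sqrt (real n)) * inverse denom_limit)"
    by (intro vanishing_add)
  also have "(\<lambda>n \<omega>. (error n \<omega> - numer n \<omega> * inverse (denom n \<omega>))
      + (inverse (denom n \<omega>) - inverse denom_limit) * numer n \<omega>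
      + (numer n \<omega> - transform n \<omega> / sqrt (real n)) * inverse denom_limit)
    = (\<lambda>n \<omega>. error n \<omega> - transform n \<omega> / sqrt (real n) / denom_limit)"
    by (intro ext) (simp add: algebra_simps divide_inverse)
  finally show ?thesis .
qed

text \<open>
  The asymptotic variance does not depend on \<open>\<sigma>\<close>: the variance \<open>\<sigma>\<^sup>2 l\<close> of the numerator and
  the square of the limit \<open>(1 + \<theta> \<rho>) l\<close> of the denominator both scale with \<open>\<sigma>\<^sup>4\<close>.
\<close>

lemma sigma2_theta_eq: "\<sigma>\<^sup>2 * limit_variance / denom_limit\<^sup>2 = sigma2_theta \<theta> \<rho>"
proof -
  define q where "q = (1 - \<theta>\<^sup>2) * (1 - \<theta> * \<rho>) * (1 - \<rho>\<^sup>2)"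
  have q: "q \<noteq> 0" using sq_less_1 by (auto simp: q_def)
  have l: "limit_variance = \<sigma>\<^sup>2 * (1 + \<theta> * \<rho>) / q" by (simp add: limit_variance_def q_def)
  have "\<sigma>\<^sup>2 * limit_variance / denom_limit\<^sup>2 = \<sigma>\<^sup>2 / ((1 + \<theta> * \<rho>)\<^sup>2 * limit_variance)"
    using limit_variance_pos by (simp add: denom_limit_def power2_eq_square)
  also have "\<dots> = q / (1 + \<theta> * \<rho>) ^ 3"
  proof -
    have "a / (u\<^sup>2 * (a * u / q)) = q / u ^ 3" if "a \<noteq> 0" "u \<noteq> 0" for a u :: real
      using that q by (simp add: field_simps power2_eq_square power3_eq_cube)
    then show ?thesis using \<sigma>_pos one_plus_pos by (simp only: l)
  qed
  finally show ?thesis by (simp add: sigma2_theta_def q_def)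
qed

lemma sigma2_theta_pos: "0 < sigma2_theta \<theta> \<rho>"
  unfolding sigma2_theta_eq[symmetric]
  using \<sigma>_pos limit_variance_pos denom_limit_pos by simp

lemma char_error_limit:
  "(\<lambda>n. expectation (\<lambda>\<omega>. iexp (t * error n \<omega>))) \<longlonglongrightarrow> of_real (exp (- (sigma2_theta \<theta> \<rho> * t\<^sup>2) / 2))"
proof (rule char_limit_of_vanishing_difference[OF vanishing_error])
  have "(\<lambda>n. expectation (\<lambda>\<omega>. iexp (t / denom_limit * (transform n \<omega> / sqrt n))))
      \<longlonglongrightarrow> exp (- ((t / denom_limit)\<^sup>2 * (\<sigma>\<^sup>2 * limit_variance) / 2))"
    by (rule char_transform_limit)
  also have "(t / denom_limit)\<^sup>2 * (\<sigma>\<^sup>2 * limit_variance) = sigma2_theta \<theta> \<rho> * t\<^sup>2"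
    by (simp add: power_divide flip: sigma2_theta_eq)
  finally show "(\<lambda>n. expectation (\<lambda>\<omega>. iexp (t * (transform n \<omega> / sqrt (real n) / denom_limit))))
      \<longlonglongrightarrow> of_real (exp (- (sigma2_theta \<theta> \<rho> * t\<^sup>2) / 2))"
    by (simp add: mult_ac)
qed measurable

theorem error_weak_limit:
  "weak_conv_m (\<lambda>n. distr M borel (error n)) (centered_normal (sigma2_theta \<theta> \<rho>))"
proof (rule levy_continuity)
  show "real_distribution (distr M borel (error n))" for n
    by (rule real_distribution_distr) simp
  show "real_distribution (centered_normal (sigma2_theta \<theta> \<rho>))"
    by (rule real_distribution_centered_normal[OF sigma2_theta_pos])
  show "(\<lambda>n. char (distr M borel (error n)) t) \<longlonglongrightarrow> char (centered_normal (sigma2_theta \<theta> \<rho>)) t" for t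
    unfolding char_centered_normal[OF sigma2_theta_pos]
    using char_error_limit[of t] by (simp add: char_def integral_distr)
qed

end

theorem theorem2p2:
  fixes M :: "'a measure"
    and \<theta> \<rho> \<sigma> :: real
    and V X \<epsilon> :: "nat \<Rightarrow> 'a \<Rightarrow> real"
  assumes "prob_space M"
    and "\<bar>\<theta>\<bar> < 1"
    and "\<bar>\<rho>\<bar> < 1"
    and "\<sigma>\<^sup>2 > 0"
    and V_indep: "prob_space.indep_vars M (\<lambda>_. borel) V {1..}"
    and V_ident: "\<And>n. n \<ge> 1 \<Longrightarrow> distr M borel (V n) = distr M borel (V 1)"
    and V_mean: "\<And>n. n \<ge> 1 \<Longrightarrow> prob_space.expectation M (V n) = 0"
    and V_variance: "\<And>n. n \<ge> 1 \<Longrightarrow> prob_space.variance M (V n) = \<sigma>\<^sup>2"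
    and V_moment4: "\<And>n. n \<ge> 1 \<Longrightarrow> integrable M (\<lambda>\<omega>. (V n \<omega>) ^ 4)"
    and X_init: "X 0 \<in> borel_measurable M"
    and eps_init: "\<epsilon> 0 \<in> borel_measurable M"
    and X_rec: "\<And>n \<omega>. n \<ge> 1 \<Longrightarrow> \<omega> \<in> space M \<Longrightarrow> X n \<omega> = \<theta> * X (n - 1) \<omega> + \<epsilon> n \<omega>"
    and eps_rec: "\<And>n \<omega>. n \<ge> 1 \<Longrightarrow> \<omega> \<in> space M \<Longrightarrow> \<epsilon> n \<omega> = \<rho> * \<epsilon> (n - 1) \<omega> + V n \<omega>"
  shows "weak_conv_m
    (\<lambda>n. distr M borel (\<lambda>\<omega>. sqrt (real n) * (ls_estimator X n \<omega> - theta_star \<theta> \<rho>)))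
    (centered_normal (sigma2_theta \<theta> \<rho>))"
proof -
  interpret prob_space M by fact
  have meas [measurable]: "V (Suc n) \<in> borel_measurable M" for n
    using V_indep by (auto simp: indep_vars_def2)
  have fourth: "expectation (\<lambda>\<omega>. V (Suc n) \<omega> ^ 4) = expectation (\<lambda>\<omega>. V 1 \<omega> ^ 4)" for n
  proof -
    have "expectation (\<lambda>\<omega>. V (Suc n) \<omega> ^ 4) = (LINT v|distr M borel (V (Suc n)). v ^ 4)"
      by (subst integral_distr) auto
    also have "distr M borel (V (Suc n)) = distr M borel (V 1)" by (rule V_ident) simp
    also have "(LINT v|distr M borel (V 1). v ^ 4) = expectation (\<lambda>\<omega>. V 1 \<omega> ^ 4)"
      using meas[of 0] by (subst integral_distr) auto
    finally show ?thesis .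
  qed
  interpret autoregression M V \<sigma> "expectation (\<lambda>\<omega>. V 1 \<omega> ^ 4)" \<theta> \<rho> X \<epsilon>
  proof unfold_locales
    show "expectation (\<lambda>\<omega>. (V (Suc n) \<omega>)\<^sup>2) = \<sigma>\<^sup>2" for n
      using V_variance[of "Suc n"] V_mean[of "Suc n"] by simp
    show "expectation (\<lambda>\<omega>. V (Suc n) \<omega> ^ 4) \<le> expectation (\<lambda>\<omega>. V 1 \<omega> ^ 4)" for n
      by (rule eq_refl, rule fourth)
    show "X (Suc n) \<omega> = \<theta> * X n \<omega> + \<epsilon> (Suc n) \<omega>" if "\<omega> \<in> space M" for n \<omega>
      using X_rec[OF _ that, of "Suc n"] by simp
    show "\<epsilon> (Suc n) \<omega> = \<rho> * \<epsilon> n \<omega> + V (Suc n) \<omega>" if "\<omega> \<in> space M" for n \<omega>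
      using eps_rec[OF _ that, of "Suc n"] by simp
    show "indep_vars (\<lambda>_. borel) V {1..}" by (fact V_indep)
    show "0 < \<sigma>\<^sup>2" by fact
  qed (simp_all add: assms(2,3) V_mean V_moment4 X_init eps_init)
  show ?thesis using error_weak_limit by (simp add: error_def[abs_def])
qed

end
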